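(* Let $S=K[x_1,\dots,x_n]$ be a polynomial ring over a field $K$, let $I\subset S$ be a monomial ideal with linear powers and let $i\ge 0$ be an integer. Then $\mathrm{HS}_i(\mathcal R(I))=\bigoplus_{k\ge1}\mathrm{HS}_i(I^k)$ is a finitely generated bigraded $\mathcal R(I)$-module.
   Context: For $\mathbf a=(a_1,\dots,a_n)\in\mathbb Z_{\ge0}^n$ write $\mathbf x^{\mathbf a}=x_1^{a_1}\cdots x_n^{a_n}$. For a monomial ideal $J\subset S$, the $i$th homological shift ideal of $J$ is the monomial ideal $$\mathrm{HS}_i(J)=(\mathbf x^{\mathbf a}\ :\ \mathrm{Tor}^S_i(K,J)_{\mathbf a}\neq 0),$$ where $\mathrm{Tor}^S_i(K,J)$ carries its natural $\mathbb Z^n$-grading and $K=S/(x_1,\dots,x_n)$. A graded ideal $J$ generated in degree $d$ has linear resolution if $\mathrm{Tor}^S_i(K,J)_j=0$ for all $i$ and all $j\ne i+d$. A monomial ideal $I$ has linear powers if $I^k$ has linear resolution for all $k\ge1$. The Rees algebra $\mathcal R(I)=\bigoplus_{k\ge0}I^k$ (with $I^0=S$) is bigraded by $\mathcal R(I)_{(d,k)}=(I^k)_d$. The $i$th homological shift algebra $\mathrm{HS}_i(\mathcal R(I))=\bigoplus_{k\ge1}\mathrm{HS}_i(I^k)$ is bigraded by $\mathrm{HS}_i(\mathcal R(I))_{(d,k)}=\mathrm{HS}_i(I^k)_d$. The $\mathcal R(I)$-module structure is the one induced by multiplication in $S$; that it is well defined amounts to $I\cdot\mathrm{HS}_i(I^k)\subseteq\mathrm{HS}_i(I^{k+1})$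 for all $k\ge1$, and this is part of the assertion. *)

theory Defs
  imports Complex_Main "HOL-Library.Poly_Mapping" "HOL-Algebra.AbelCoset" "HOL-Algebra.Module"
begin

text \<open>
  Exponent vectors are finitely supported functions, so that the convolution product of
  \<^theory>\<open>HOL-Library.Poly_Mapping\<close> makes \<open>('x, 'k) poly_ring\<close> the polynomial ring
  \<open>S\<close> over \<open>'k\<close> with one variable for each element of \<open>'x\<close>.
\<close>

type_synonym 'x expo = "'x \<Rightarrow>\<^sub>0 nat"
type_synonym ('x, 'k) poly_ring = "'x expo \<Rightarrow>\<^sub>0 'k"

definition monomial :: "'x expo \<Rightarrow> ('x, 'k::field) poly_ring" where
  "monomial a = Poly_Mapping.single a 1"

definition expo_degree :: "'x expo \<Rightarrow> nat" where
  "expo_degree a = (\<Sum>x\<in>Poly_Mapping.keys a. Poly_Mapping.lookup a x)"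

definition homogeneous :: "nat \<Rightarrow> ('x, 'k::field) poly_ring \<Rightarrow> bool" where
  "homogeneous d f \<longleftrightarrow> (\<forall>a\<in>Poly_Mapping.keys f. expo_degree a = d)"


section \<open>Ideals of \<open>S\<close>\<close>

text \<open>The ideal generated by a set: its span in the ring regarded as a module over itself.\<close>

definition ideal_gen :: "'a::comm_ring_1 set \<Rightarrow> 'a set" where
  "ideal_gen = Modules.module.span (*)"

definition ideal_times :: "'a::comm_ring_1 set \<Rightarrow> 'a set \<Rightarrow> 'a set" where
  "ideal_times I J = ideal_gen {f * g | f g. f \<in> I \<and> g \<in> J}"

primrec ideal_power :: "'a::comm_ring_1 set \<Rightarrow> nat \<Rightarrow> 'a set" where
  "ideal_power I 0 = UNIV"
| "ideal_power I (Suc k) = ideal_times I (ideal_power I k)"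

definition monomial_ideal :: "('x, 'k::field) poly_ring set \<Rightarrow> bool" where
  "monomial_ideal I \<longleftrightarrow> (\<exists>A. I = ideal_gen (monomial ` A))"

definition generated_in_degree :: "nat \<Rightarrow> ('x, 'k::field) poly_ring set \<Rightarrow> bool" where
  "generated_in_degree d J \<longleftrightarrow> (\<exists>G. (\<forall>f\<in>G. homogeneous d f) \<and> J = ideal_gen G)"


section \<open>Multigraded free resolutions of \<open>K\<close>\<close>

text \<open>
  Free modules are realised inside the module of finitely supported functions from \<open>nat\<close>
  to \<open>S\<close>: a set \<open>B\<close> of indices gives the free module with basis \<open>(e\<^sub>b)\<close>, \<open>b \<in> B\<close>. Only
  countable bases are needed, since \<open>K\<close> even has a resolution by finite free modules.
\<close>

type_synonym ('x, 'k) free_vec = "nat \<Rightarrow>\<^sub>0 ('x, 'k) poly_ring"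

definition scal :: "('x, 'k::field) poly_ring \<Rightarrow> ('x, 'k) free_vec \<Rightarrow> ('x, 'k) free_vec" where
  "scal s v = Poly_Mapping.map (\<lambda>c. s * c) v"

text \<open>
  A complex \<open>\<dots> \<rightarrow> F\<^sub>2 \<rightarrow> F\<^sub>1 \<rightarrow> F\<^sub>0 \<rightarrow> K\<close>. Here \<open>basis i\<close> indexes a basis of \<open>F\<^sub>i\<close>, \<open>mdeg i b\<close> is the
  multidegree of the basis vector \<open>e\<^sub>b\<close> of \<open>F\<^sub>i\<close>, \<open>bd i\<close> is the differential \<open>F\<^sub>i \<rightarrow> F\<^sub>i\<^sub>-\<^sub>1\<close>
  (relevant for \<open>i \<ge> 1\<close> only), and \<open>aug\<close> is the augmentation \<open>F\<^sub>0 \<rightarrow> K\<close>.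
\<close>

record (overloaded) ('x, 'k) free_complex =
  basis :: "nat \<Rightarrow> nat set"
  mdeg :: "nat \<Rightarrow> nat \<Rightarrow> 'x expo"
  bd :: "nat \<Rightarrow> ('x, 'k) free_vec \<Rightarrow> ('x, 'k) free_vec"
  aug :: "('x, 'k) free_vec \<Rightarrow> 'k"

text \<open>
  \<open>tensor F i J\<close> is \<open>F\<^sub>i \<otimes> J\<close> for an ideal \<open>J\<close> of \<open>S\<close>. As \<open>F\<^sub>i\<close> is free, \<open>F\<^sub>i \<otimes> J\<close> is a direct sum of
  copies of \<open>J\<close> indexed by the basis; it is embedded in \<open>F\<^sub>i = F\<^sub>i \<otimes> S\<close> as the vectors with all
  coordinates in \<open>J\<close>, and under this identification the differential of \<open>F \<otimes> J\<close> is the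
  restriction of that of \<open>F\<close>.
\<close>

definition tensor ::
    "('x, 'k::field) free_complex \<Rightarrow> nat \<Rightarrow> ('x, 'k) poly_ring set \<Rightarrow> ('x, 'k) free_vec set" where
  "tensor F i J =
     {v. Poly_Mapping.keys v \<subseteq> basis F i \<and> (\<forall>b\<in>basis F i. Poly_Mapping.lookup v b \<in> J)}"

abbreviation free_mod :: "('x, 'k::field) free_complex \<Rightarrow> nat \<Rightarrow> ('x, 'k) free_vec set" where
  "free_mod F i \<equiv> tensor F i UNIV"

text \<open>The component of multidegree \<open>a\<close>.\<close>

definition tensor_comp ::
    "('x, 'k::field) free_complex \<Rightarrow> nat \<Rightarrow> ('x, 'k) poly_ring set \<Rightarrow> 'x expo \<Rightarrow> ('x, 'k) free_vec set"
  where
  "tensor_comp F i J a =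
     {v \<in> tensor F i J.
        \<forall>b\<in>basis F i. \<forall>m\<in>Poly_Mapping.keys (Poly_Mapping.lookup v b). m + mdeg F i b = a}"

text \<open>
  \<open>K = S/(x\<^sub>1,\<dots>,x\<^sub>n)\<close> is the type \<open>'k\<close>, on which a polynomial acts by multiplication with its
  constant term; it is concentrated in multidegree \<open>0\<close>. Linear maps are linear on the whole
  ambient type, which is no restriction: a linear map on \<open>F\<^sub>i\<close> can be extended by zero on the
  unused basis vectors.
\<close>

definition graded_free_resolution :: "('x, 'k::field) free_complex \<Rightarrow> bool" where
  "graded_free_resolution F \<longleftrightarrow>
     (\<forall>i\<ge>1. module_hom scal scal (bd F i)) \<and>
     (\<forall>i\<ge>1. bd F i ` free_mod F i \<subseteq> free_mod F (i - 1)) \<and>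
     (\<forall>i\<ge>1. \<forall>a. bd F i ` tensor_comp F i UNIV a \<subseteq> tensor_comp F (i - 1) UNIV a) \<and>
     module_hom scal (\<lambda>s c. Poly_Mapping.lookup s 0 * c) (aug F) \<and>
     (\<forall>a. a \<noteq> 0 \<longrightarrow> aug F ` tensor_comp F 0 UNIV a \<subseteq> {0}) \<and>
     aug F ` free_mod F 0 = UNIV \<and>
     {v \<in> free_mod F 0. aug F v = 0} = bd F 1 ` free_mod F 1 \<and>
     (\<forall>i\<ge>1. {v \<in> free_mod F i. bd F i v = 0} = bd F (i + 1) ` free_mod F (i + 1))"


section \<open>Tor and homological shift ideals\<close>

text \<open>The cycles and boundaries of multidegree \<open>a\<close> of the complex \<open>F \<otimes> J\<close>.\<close>

definition tor_cycles ::
    "('x, 'k::field) free_complex \<Rightarrow> nat \<Rightarrow> ('x, 'k) poly_ring set \<Rightarrow> 'x expo \<Rightarrow> ('x, 'k) free_vec set"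
  where
  "tor_cycles F i J a = {v \<in> tensor_comp F i J a. i \<ge> 1 \<longrightarrow> bd F i v = 0}"

definition tor_boundaries ::
    "('x, 'k::field) free_complex \<Rightarrow> nat \<Rightarrow> ('x, 'k) poly_ring set \<Rightarrow> 'x expo \<Rightarrow> ('x, 'k) free_vec set"
  where
  "tor_boundaries F i J a = bd F (i + 1) ` tensor_comp F (i + 1) J a"

text \<open>
  \<open>Tor\<^sub>i(K,J)\<^sub>a \<noteq> 0\<close>. The homology of \<open>F \<otimes> J\<close> is, up to graded isomorphism, independent of the
  multigraded free resolution \<open>F\<close> of \<open>K\<close>, so it does not matter which one is taken. Since \<open>S\<close>,
  \<open>K\<close> and \<open>J\<close> live in nonnegative multidegrees, so does Tor.
\<close>

definition tor_nonzero :: "nat \<Rightarrow> ('x, 'k::field) poly_ring set \<Rightarrow> 'x expo \<Rightarrow> bool" where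
  "tor_nonzero i J a \<longleftrightarrow>
     (\<exists>F. graded_free_resolution F \<and> \<not> tor_cycles F i J a \<subseteq> tor_boundaries F i J a)"

definition HS :: "nat \<Rightarrow> ('x, 'k::field) poly_ring set \<Rightarrow> ('x, 'k) poly_ring set" where
  "HS i J = ideal_gen {monomial a | a. tor_nonzero i J a}"

text \<open>The component of Tor of total degree \<open>j\<close> is the sum of those of multidegree \<open>a\<close> with \<open>|a| = j\<close>.\<close>

definition has_linear_resolution :: "('x, 'k::field) poly_ring set \<Rightarrow> bool" where
  "has_linear_resolution J \<longleftrightarrow>
     (\<exists>d. generated_in_degree d J \<and>
        (\<forall>i j. j \<noteq> i + d \<longrightarrow> \<not> (\<exists>a. expo_degree a = j \<and> tor_nonzero i J a)))"

definition linear_powers :: "('x, 'k::field) poly_ring set \<Rightarrow> bool" where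
  "linear_powers I \<longleftrightarrow> (\<forall>k\<ge>1. has_linear_resolution (ideal_power I k))"


section \<open>Bigraded modules\<close>

text \<open>
  \<open>gr d k\<close> is the component of bidegree \<open>(d,k)\<close>; components with a negative index are zero.
\<close>

definition bigraded_group :: "('b, 'c) ring_scheme \<Rightarrow> (nat \<Rightarrow> nat \<Rightarrow> 'b set) \<Rightarrow> bool" where
  "bigraded_group M gr \<longleftrightarrow>
     abelian_group M \<and>
     (\<forall>d k. additive_subgroup (gr d k) M) \<and>
     (\<forall>m\<in>carrier M. \<exists>!c :: nat \<times> nat \<Rightarrow> 'b.
        (\<forall>d k. c (d, k) \<in> gr d k) \<and> finite {p. c p \<noteq> \<zero>\<^bsub>M\<^esub>} \<and>
        m = (\<Oplus>\<^bsub>M\<^esub>p\<in>{p. c p \<noteq> \<zero>\<^bsub>M\<^esub>}. c p))"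

definition bigraded_ring :: "('a, 'c) ring_scheme \<Rightarrow> (nat \<Rightarrow> nat \<Rightarrow> 'a set) \<Rightarrow> bool" where
  "bigraded_ring R gr \<longleftrightarrow>
     cring R \<and> bigraded_group R gr \<and> \<one>\<^bsub>R\<^esub> \<in> gr 0 0 \<and>
     (\<forall>d k e l. \<forall>r\<in>gr d k. \<forall>s\<in>gr e l. r \<otimes>\<^bsub>R\<^esub> s \<in> gr (d + e) (k + l))"

definition bigraded_module ::
    "('a, 'c) ring_scheme \<Rightarrow> (nat \<Rightarrow> nat \<Rightarrow> 'a set) \<Rightarrow>
     ('a, 'b, 'd) module_scheme \<Rightarrow> (nat \<Rightarrow> nat \<Rightarrow> 'b set) \<Rightarrow> bool" where
  "bigraded_module R grR M grM \<longleftrightarrow>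
     bigraded_ring R grR \<and> Module.module R M \<and> bigraded_group M grM \<and>
     (\<forall>d k e l. \<forall>r\<in>grR d k. \<forall>m\<in>grM e l. r \<odot>\<^bsub>M\<^esub> m \<in> grM (d + e) (k + l))"

definition finitely_generated_module ::
    "('a, 'c) ring_scheme \<Rightarrow> ('a, 'b, 'd) module_scheme \<Rightarrow> bool" where
  "finitely_generated_module R M \<longleftrightarrow>
     (\<exists>A. finite A \<and> A \<subseteq> carrier M \<and>
        (\<forall>m\<in>carrier M. \<exists>r\<in>A \<rightarrow> carrier R. m = (\<Oplus>\<^bsub>M\<^esub>g\<in>A. r g \<odot>\<^bsub>M\<^esub> g)))"


section \<open>Rees algebra and homological shift algebra\<close>

text \<open>
  Both are realised inside \<open>S[t]\<close>, whose elements are the finitely supported functions from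
  \<open>nat\<close> to \<open>S\<close> with the convolution product: \<open>f\<close> stands for the sum of the
  \<open>lookup f k \<sqdot> t\<^sup>k\<close>, and the \<open>k\<close>-th summand of a direct sum is placed in \<open>t\<close>-degree \<open>k\<close>.
\<close>

type_synonym ('x, 'k) poly_ring_t = "nat \<Rightarrow>\<^sub>0 ('x, 'k) poly_ring"

definition direct_sum ::
    "(nat \<Rightarrow> ('x, 'k::field) poly_ring set) \<Rightarrow> ('x, 'k) poly_ring_t set" where
  "direct_sum N = {f. \<forall>k. Poly_Mapping.lookup f k \<in> N k}"

definition direct_sum_comp ::
    "(nat \<Rightarrow> ('x, 'k::field) poly_ring set) \<Rightarrow> nat \<Rightarrow> nat \<Rightarrow> ('x, 'k) poly_ring_t set" where
  "direct_sum_comp N d k = {Poly_Mapping.single k s | s. s \<in> N k \<and> homogeneous d s}"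

definition rees_algebra :: "('x, 'k::field) poly_ring set \<Rightarrow> ('x, 'k) poly_ring_t ring" where
  "rees_algebra I =
     \<lparr>carrier = direct_sum (ideal_power I), mult = (*), one = 1, zero = 0, add = (+)\<rparr>"

definition rees_comp ::
    "('x, 'k::field) poly_ring set \<Rightarrow> nat \<Rightarrow> nat \<Rightarrow> ('x, 'k) poly_ring_t set" where
  "rees_comp I = direct_sum_comp (ideal_power I)"

definition HS_summand ::
    "nat \<Rightarrow> ('x, 'k::field) poly_ring set \<Rightarrow> nat \<Rightarrow> ('x, 'k) poly_ring set" where
  "HS_summand i I k = (if k = 0 then {0} else HS i (ideal_power I k))"

text \<open>
  The fields \<open>mult\<close> and \<open>one\<close> are not used by the library's notion of a module; \<open>smult\<close> is the action
  induced by multiplication in \<open>S\<close>.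
\<close>

definition HS_algebra ::
    "nat \<Rightarrow> ('x, 'k::field) poly_ring set \<Rightarrow> (('x, 'k) poly_ring_t, ('x, 'k) poly_ring_t) module" where
  "HS_algebra i I =
     \<lparr>carrier = direct_sum (HS_summand i I), mult = (*), one = 1, zero = 0, add = (+),
      smult = (*)\<rparr>"

definition HS_comp ::
    "nat \<Rightarrow> ('x, 'k::field) poly_ring set \<Rightarrow> nat \<Rightarrow> nat \<Rightarrow> ('x, 'k) poly_ring_t set" where
  "HS_comp i I = direct_sum_comp (HS_summand i I)"

end

theory Submission
  imports Defs "HOL-Library.Countable"
begin

text \<open>
  By comparison of resolutions, Tor may be computed with the Koszul complex, whose basis in homological
  degree \<open>i\<close> sits in degree \<open>i\<close>. If \<open>I\<close> is generated in degree \<open>d\<close> and has linear powers, then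
  \<open>Tor\<^sub>i(K, I\<^sup>k)\<close> lives in degree \<open>i + kd\<close>, where the Koszul complex of \<open>I\<^sup>k\<close> has no boundaries. So the
  nonzero classes are the nonzero cycles, and these stay nonzero when multiplied by a generator of \<open>I\<close>.
  Moreover, the coefficient monomials of a cycle have degree \<open>kd\<close>, that is, they are products of \<open>k\<close>
  generators of \<open>I\<close>; Dickson's lemma for the exponents occurring in these products gives finite generation.
\<close>

text \<open>\<open>tor_nonzero\<close> asks for some resolution, so a nonzero class arrives with an
  arbitrary \<open>F\<close>. Only a comparison of resolutions that respects multidegrees and
  tensoring with an ideal makes the degrees of the Koszul basis available. Boundaries vanish by an
  off-by-one: Koszul basis vectors in homological degree i + 1 have total degree i + 1, and every
  term of an element of I^k has degree at least kd, so a nonzero preimage of a boundary has degree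
  at least i + 1 + kd, one more than the degree of the class. Applied to the exponent vectors of the
  shift ideals, Dickson's lemma would only provide a cofactor in S, whereas passing from t-degree k'
  to k requires a cofactor in I^(k - k'). It is therefore applied to the multiplicities with which
  the generators of I occur in a product: lowering these changes the exponent and the t-degree
  consistently.\<close>

abbreviation "lookup \<equiv> Poly_Mapping.lookup"
abbreviation "keys \<equiv> Poly_Mapping.keys"
abbreviation "single \<equiv> Poly_Mapping.single"

section \<open>Monomial ideals\<close>

lemma poly_mapping_sum_single: "(\<Sum>m\<in>keys f. single m (lookup f m)) = f"
  by (rule poly_mapping_eqI) (auto simp: lookup_sum lookup_single when_def in_keys_iff)

definition restrict_keys :: "('a \<Rightarrow> bool) \<Rightarrow> ('a \<Rightarrow>\<^sub>0 'b::zero) \<Rightarrow> ('a \<Rightarrow>\<^sub>0 'b)" where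
  "restrict_keys P f = Poly_Mapping.mapp (\<lambda>m c. if P m then c else 0) f"

lemma lookup_restrict_keys: "lookup (restrict_keys P f) m = (if P m then lookup f m else 0)"
  by (auto simp: restrict_keys_def lookup_mapp in_keys_iff when_def)

lemma keys_restrict_keys: "keys (restrict_keys P f) = {m \<in> keys f. P m}"
  by (auto simp: in_keys_iff lookup_restrict_keys simp del: lookup_not_eq_zero_eq_in_keys split: if_splits)

lemma lookup_single_times:
  fixes a :: "'a::cancel_comm_monoid_add" and c :: "'b::comm_ring_1"
  shows "lookup (single a c * f) (a + m) = c * lookup f m"
proof -
  have "single a c * f = (\<Sum>k\<in>keys f. single (a + k) (c * lookup f k))"
    by (subst (1) poly_mapping_sum_single[of f, symmetric]) (simp add: sum_distrib_left mult_single)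
  then show ?thesis
    by (auto simp: lookup_sum lookup_single when_def in_keys_iff)
qed

lemma lookup_single_times_eq_0:
  fixes a :: "'a::cancel_comm_monoid_add" and c :: "'b::comm_ring_1"
  assumes "\<And>t. m \<noteq> a + t"
  shows "lookup (single a c * f) m = 0"
proof (rule ccontr)
  assume "lookup (single a c * f) m \<noteq> 0"
  then have "m \<in> keys (single a c * f)" by (simp add: in_keys_iff)
  with keys_mult[of "single a c" f] assms show False
    by (auto simp del: lookup_not_eq_zero_eq_in_keys split: if_splits)
qed

lemma lookup_single_0_times:
  fixes c :: "'b::comm_ring_1"
  shows "lookup (single (0::'a::cancel_comm_monoid_add) c * f) m = c * lookup f m"
  using lookup_single_times[of 0 c f m] by simp

lemma monomial_times: "monomial a * monomial b = monomial (a + b)"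
  by (simp add: monomial_def mult_single)

lemma monomial_0: "monomial 0 = 1"
  by (simp add: monomial_def)

lemma keys_monomial: "keys (monomial a :: ('x, 'k::field) poly_ring) = {a}"
  by (simp add: monomial_def)

lemma module_times: "Modules.module ((*) :: 'a::comm_ring_1 \<Rightarrow> 'a \<Rightarrow> 'a)"
  by unfold_locales (simp_all add: algebra_simps)

lemma ideal_gen_base: "f \<in> A \<Longrightarrow> f \<in> ideal_gen A"
  unfolding ideal_gen_def by (rule module.span_base[OF module_times])

lemma ideal_gen_0: "0 \<in> ideal_gen A"
  unfolding ideal_gen_def by (rule module.span_zero[OF module_times])

lemma ideal_gen_add: "f \<in> ideal_gen A \<Longrightarrow> g \<in> ideal_gen A \<Longrightarrow> f + g \<in> ideal_gen A"
  unfolding ideal_gen_def by (rule module.span_add[OF module_times])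

lemma ideal_gen_diff: "f \<in> ideal_gen A \<Longrightarrow> g \<in> ideal_gen A \<Longrightarrow> f - g \<in> ideal_gen A"
  unfolding ideal_gen_def by (rule module.span_diff[OF module_times])

lemma ideal_gen_neg: "f \<in> ideal_gen A \<Longrightarrow> - f \<in> ideal_gen A"
  unfolding ideal_gen_def by (rule module.span_neg[OF module_times])

lemma ideal_gen_times: "f \<in> ideal_gen A \<Longrightarrow> s * f \<in> ideal_gen A"
  unfolding ideal_gen_def by (rule module.span_scale[OF module_times])

lemma ideal_gen_sum: "(\<And>x. x \<in> X \<Longrightarrow> f x \<in> ideal_gen A) \<Longrightarrow> sum f X \<in> ideal_gen A"
  unfolding ideal_gen_def by (rule module.span_sum[OF module_times])

lemma ideal_gen_least:
  assumes "A \<subseteq> J" "0 \<in> J" "\<And>f g. f \<in> J \<Longrightarrow> g \<in> J \<Longrightarrow> f + g \<in> J" "\<And>s f. f \<in> J \<Longrightarrow> s * f \<in> J"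
  shows "ideal_gen A \<subseteq> J"
  unfolding ideal_gen_def
  by (rule module.span_minimal[OF module_times]) (use assms in \<open>auto simp: module.subspace_def[OF module_times]\<close>)

lemma ideal_gen_least_gen: "A \<subseteq> ideal_gen B \<Longrightarrow> ideal_gen A \<subseteq> ideal_gen B"
  by (rule ideal_gen_least) (auto intro: ideal_gen_0 ideal_gen_add ideal_gen_times)

definition upset :: "'a::monoid_add set \<Rightarrow> 'a set" where
  "upset A = {a + t | a t. a \<in> A}"

text \<open>Every term of a member is a multiple of some generator, so membership depends on the
  support alone. Later questions about monomial ideals are thereby settled on exponents.\<close>

lemma ideal_gen_monomials:
  "ideal_gen (monomial ` A) = {f :: ('x, 'k::field) poly_ring. keys f \<subseteq> upset A}"
proof
  show "ideal_gen (monomial ` A) \<subseteq> {f :: ('x, 'k) poly_ring. keys f \<subseteq> upset A}"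
  proof (rule ideal_gen_least)
    show "monomial ` A \<subseteq> {f :: ('x, 'k) poly_ring. keys f \<subseteq> upset A}"
    proof (clarsimp simp: keys_monomial)
      fix a assume "a \<in> A"
      then show "a \<in> upset A" unfolding upset_def by (metis (mono_tags, lifting) CollectI add.right_neutral)
    qed
    show "f + g \<in> {f. keys f \<subseteq> upset A}" if "f \<in> {f. keys f \<subseteq> upset A}" "g \<in> {f. keys f \<subseteq> upset A}"
      for f g :: "('x, 'k) poly_ring"
      using that keys_add[of f g] by auto
    show "s * f \<in> {f. keys f \<subseteq> upset A}" if "f \<in> {f. keys f \<subseteq> upset A}" for s f :: "('x, 'k) poly_ring"
    proof clarsimp
      fix m assume "m \<in> keys (s * f)"
      then obtain p q where "m = p + q" "q \<in> keys f" using keys_mult[of s f] by auto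
      with that obtain a t where "m = p + (a + t)" "a \<in> A" by (auto simp: upset_def)
      then have "m = a + (p + t)" by (simp add: ac_simps)
      with \<open>a \<in> A\<close> show "m \<in> upset A" by (auto simp: upset_def)
    qed
  qed simp
next
  show "{f :: ('x, 'k) poly_ring. keys f \<subseteq> upset A} \<subseteq> ideal_gen (monomial ` A)"
  proof clarify
    fix f :: "('x, 'k) poly_ring" assume f: "keys f \<subseteq> upset A"
    have "single m (lookup f m) \<in> ideal_gen (monomial ` A)" if m_in: "m \<in> keys f" for m
    proof -
      obtain a t where m: "m = a + t" "a \<in> A" using f m_in unfolding upset_def by blast
      have "single t (lookup f m) * monomial a \<in> ideal_gen (monomial ` A)"
        using m by (intro ideal_gen_times ideal_gen_base) auto
      then show ?thesis by (simp add: monomial_def mult_single m add.commute)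
    qed
    then have "(\<Sum>m\<in>keys f. single m (lookup f m)) \<in> ideal_gen (monomial ` A)"
      by (intro ideal_gen_sum)
    then show "f \<in> ideal_gen (monomial ` A)" by (simp add: poly_mapping_sum_single)
  qed
qed

text \<open>The k-fold sumset: exponents of products of \<open>k\<close> generators, repetitions
  allowed. The base case \<open>{0}\<close> matches \<open>ideal_power I 0 = UNIV\<close>, which is
  generated by the monomial 1.\<close>

primrec nsums :: "'a::comm_monoid_add set \<Rightarrow> nat \<Rightarrow> 'a set" where
  "nsums G 0 = {0}"
| "nsums G (Suc k) = {g + e | g e. g \<in> G \<and> e \<in> nsums G k}"

lemma ideal_times_mono: "f \<in> I \<Longrightarrow> g \<in> J \<Longrightarrow> f * g \<in> ideal_times I J"
  unfolding ideal_times_def by (rule ideal_gen_base) auto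

text \<open>For a fixed second factor the admissible first factors form an ideal, and then the same
  holds with the roles exchanged; so products of generators decide.\<close>

lemma times_mem_ideal_gen:
  assumes "\<And>a b. a \<in> A \<Longrightarrow> b \<in> B \<Longrightarrow> a * b \<in> ideal_gen C" and "f \<in> ideal_gen A" "g \<in> ideal_gen B"
  shows "f * g \<in> ideal_gen C"
proof -
  have "ideal_gen B \<subseteq> {g. f * g \<in> ideal_gen C}"
  proof (rule ideal_gen_least)
    show "B \<subseteq> {g. f * g \<in> ideal_gen C}"
    proof clarify
      fix b assume b: "b \<in> B"
      have "ideal_gen A \<subseteq> {f. f * b \<in> ideal_gen C}"
        by (rule ideal_gen_least) (use b assms(1) in \<open>auto simp: distrib_right mult.assoc intro: ideal_gen_0 ideal_gen_add ideal_gen_times\<close>)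
      then show "f * b \<in> ideal_gen C" using assms by auto
    qed
  qed (auto simp: distrib_left mult.left_commute intro: ideal_gen_0 ideal_gen_add ideal_gen_times)
  then show ?thesis using assms by auto
qed

lemma ideal_times_monomials:
  "ideal_times (ideal_gen (monomial ` A)) (ideal_gen (monomial ` B)) =
     ideal_gen (monomial ` {a + b | a b. a \<in> A \<and> b \<in> B})"  (is "?L = ideal_gen ?C")
proof
  have "f * g \<in> ideal_gen ?C" if "f \<in> monomial ` A" "g \<in> monomial ` B" for f g :: "('a, 'b) poly_ring"
    by (rule ideal_gen_base) (use that in \<open>force simp: monomial_times\<close>)
  then show "?L \<subseteq> ideal_gen ?C"
    unfolding ideal_times_def by (intro ideal_gen_least_gen) (auto intro: times_mem_ideal_gen)
  show "ideal_gen ?C \<subseteq> ?L"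
    unfolding ideal_times_def
    by (rule ideal_gen_least_gen, clarsimp simp: monomial_times[symmetric])
      (rule ideal_gen_base, blast intro: ideal_gen_base)
qed

text \<open>Presents the whole ring in the form \<open>ideal_gen A\<close>, so that lemmas on F
  tensor an ideal also cover the free modules themselves.\<close>

lemma ideal_gen_1: "ideal_gen {1} = UNIV"
proof -
  have "s * 1 \<in> ideal_gen {1}" for s :: 'a by (intro ideal_gen_times ideal_gen_base) simp
  then show ?thesis by auto
qed

lemma ideal_power_monomials:
  "ideal_power (ideal_gen (monomial ` G)) k = ideal_gen (monomial ` nsums G k)"
  by (induction k) (simp_all add: monomial_0 ideal_gen_1 ideal_times_monomials)

lemma nsums_add: "e \<in> nsums G k \<Longrightarrow> e' \<in> nsums G l \<Longrightarrow> e + e' \<in> nsums G (k + l)"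
proof (induction k arbitrary: e)
  case (Suc k)
  then obtain g e0 where e: "e = g + e0" "g \<in> G" "e0 \<in> nsums G k" by auto
  have "e0 + e' \<in> nsums G (k + l)" using Suc.IH e Suc.prems by blast
  with e show ?case by (auto simp: add.assoc)
qed simp

lemma times_mem_monomials:
  assumes "\<And>a b. a \<in> A \<Longrightarrow> b \<in> B \<Longrightarrow> a + b \<in> C"
    and "f \<in> ideal_gen (monomial ` A)" "g \<in> ideal_gen (monomial ` B)"
  shows "f * g \<in> ideal_gen (monomial ` C)"
  by (rule times_mem_ideal_gen[OF _ assms(2,3)])
    (use assms(1) in \<open>auto simp: monomial_times intro!: ideal_gen_base\<close>)

section \<open>Total degree of exponent vectors in finitely many variables\<close>

lemma expo_degree_sum_UNIV: "expo_degree (a :: 'x::finite expo) = (\<Sum>x\<in>UNIV. lookup a x)"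
  unfolding expo_degree_def by (rule sum.mono_neutral_left) (auto simp: in_keys_iff)

lemma expo_degree_add: "expo_degree (a + b :: 'x::finite expo) = expo_degree a + expo_degree b"
  by (simp add: expo_degree_sum_UNIV lookup_add sum.distrib)

lemma expo_degree_0: "expo_degree 0 = 0"
  by (simp add: expo_degree_def)

lemma expo_degree_eq_0: "expo_degree (a :: 'x::finite expo) = 0 \<longleftrightarrow> a = 0"
  by (simp add: expo_degree_sum_UNIV poly_mapping_eq_iff fun_eq_iff)

lemma finite_expo_degree: "finite {a :: 'x::finite expo. expo_degree a = d}"
proof (rule inj_on_finite)
  show "inj_on lookup {a :: 'x::finite expo. expo_degree a = d}"
    by (rule inj_onI) (metis poly_mapping_eq_iff)
  show "lookup ` {a :: 'x::finite expo. expo_degree a = d} \<subseteq> PiE UNIV (\<lambda>_. {..d})"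
  proof clarify
    fix a :: "'x expo" show "lookup a \<in> PiE UNIV (\<lambda>_. {..expo_degree a})"
      unfolding expo_degree_sum_UNIV by (simp add: PiE_iff member_le_sum)
  qed
  show "finite (PiE (UNIV :: 'x set) (\<lambda>_. {..d}))"
    by (intro finite_PiE) auto
qed

section \<open>Bigraded direct sums of monomial ideals\<close>

text \<open>Bridge from sums in the record structures to the type class \<open>sum\<close>. Infinite
  index sets agree too, because both sums are then zero.\<close>

lemma finsum_eq_sum:
  assumes "abelian_monoid M" "add M = (+)" "zero M = (0::'b::comm_monoid_add)"
    and "f \<in> X \<rightarrow> carrier M"
  shows "finsum M f X = sum f X"
proof (cases "finite X")
  case True
  from this \<open>f \<in> X \<rightarrow> carrier M\<close> show ?thesis
  proof (induction X)
    case empty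
    show ?case using assms by (simp add: abelian_monoid.finsum_empty)
  next
    case (insert x X)
    then have "f \<in> X \<rightarrow> carrier M" "f x \<in> carrier M" by auto
    with insert assms show ?case by (simp add: abelian_monoid.finsum_insert)
  qed
next
  case False
  with assms show ?thesis by (simp add: abelian_monoid.finsum_infinite)
qed

lemma direct_sum_comp_subset: "(\<And>k. 0 \<in> N k) \<Longrightarrow> direct_sum_comp N d k \<subseteq> direct_sum N"
  by (auto simp: direct_sum_comp_def direct_sum_def lookup_single when_def)

text \<open>Only the component of bidegree \<open>(expo_degree m, k)\<close> can contribute to the
  coefficient of \<open>m\<close> in t-degree \<open>k\<close>. This gives both existence and
  uniqueness of the bigraded decomposition.\<close>

lemma lookup_lookup_sum_components:
  fixes c :: "nat \<times> nat \<Rightarrow> ('x, 'k::field) poly_ring_t"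
  assumes c: "\<And>d k. c (d, k) \<in> direct_sum_comp N d k" and fin: "finite {p. c p \<noteq> 0}"
  shows "lookup (lookup (\<Sum>p\<in>{p. c p \<noteq> 0}. c p) k) m = lookup (lookup (c (expo_degree m, k)) k) m"
proof -
  have *: "lookup (lookup (c p) k) m = 0" if "p \<noteq> (expo_degree m, k)" for p
  proof -
    obtain d l where p: "p = (d, l)" by (cases p)
    from c[of d l] obtain s where s: "c p = single l s" "homogeneous d s"
      by (auto simp: direct_sum_comp_def p)
    show ?thesis
    proof (cases "l = k \<and> m \<in> keys s")
      case True
      with s(2) have "expo_degree m = d" by (auto simp: homogeneous_def)
      with True that p show ?thesis by simp
    next
      case False
      then show ?thesis by (auto simp: s lookup_single when_def in_keys_iff)
    qed
  qed
  have "lookup (lookup (\<Sum>p\<in>{p. c p \<noteq> 0}. c p) k) m = (\<Sum>p\<in>{p. c p \<noteq> 0}. lookup (lookup (c p) k) m)"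
    by (simp add: lookup_sum)
  also have "\<dots> = (\<Sum>p\<in>{p. c p \<noteq> 0}. if p = (expo_degree m, k) then lookup (lookup (c p) k) m else 0)"
    by (rule sum.cong) (use * in auto)
  also have "\<dots> = lookup (lookup (c (expo_degree m, k)) k) m"
    using fin by simp
  finally show ?thesis .
qed

lemma abelian_group_direct_sum:
  fixes M :: "(('x, 'k::field) poly_ring_t, 'c) ring_scheme"
  assumes "\<And>k. N k = ideal_gen (G k)"
    and M: "carrier M = direct_sum N" "add M = (+)" "zero M = 0"
  shows "abelian_group M"
proof (rule abelian_groupI)
  fix f assume "f \<in> carrier M"
  then have "- f \<in> carrier M" using assms(1) by (auto simp: M direct_sum_def intro: ideal_gen_neg)
  moreover have "- f \<oplus>\<^bsub>M\<^esub> f = \<zero>\<^bsub>M\<^esub>" by (simp add: M)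
  ultimately show "\<exists>g\<in>carrier M. g \<oplus>\<^bsub>M\<^esub> f = \<zero>\<^bsub>M\<^esub>" by blast
qed (use assms(1) in \<open>auto simp: M direct_sum_def lookup_add ac_simps intro: ideal_gen_add ideal_gen_0\<close>)

text \<open>Generation by monomials makes each \<open>N k\<close> closed under discarding terms
  (\<open>restr\<close>), hence under taking homogeneous components; this is why the components of a
  member stay in the direct sum.\<close>

lemma bigraded_group_direct_sum:
  fixes M :: "(('x, 'k::field) poly_ring_t, 'c) ring_scheme"
  assumes N: "\<And>k. N k = ideal_gen (monomial ` A k)"
    and M: "carrier M = direct_sum N" "add M = (+)" "zero M = 0"
  shows "bigraded_group M (direct_sum_comp N)"
  unfolding bigraded_group_def
proof (intro conjI allI ballI)
  show ab: "abelian_group M" by (rule abelian_group_direct_sum[OF N M])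
  have N0: "0 \<in> N k" for k by (simp add: N ideal_gen_0)
  fix d k
  show "additive_subgroup (direct_sum_comp N d k) M"
  proof (rule additive_subgroupI, rule group.subgroupI)
    show "Group.group (add_monoid M)" using ab by (rule abelian_group.a_group)
    show "direct_sum_comp N d k \<subseteq> carrier (add_monoid M)"
      using direct_sum_comp_subset[of N, OF N0] by (simp add: M)
    have "single k 0 \<in> direct_sum_comp N d k"
      unfolding direct_sum_comp_def using N0 by (force simp: homogeneous_def)
    then show "direct_sum_comp N d k \<noteq> {}" by auto
  next
    fix f assume f: "f \<in> direct_sum_comp N d k"
    then obtain s where s: "f = single k s" "s \<in> N k" "homogeneous d s" by (auto simp: direct_sum_comp_def)
    have "- f \<in> direct_sum_comp N d k"
      unfolding direct_sum_comp_def using s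
      by (auto simp: single_uminus[symmetric] N homogeneous_def intro!: exI[of _ "- s"] ideal_gen_neg)
    moreover have "inv\<^bsub>add_monoid M\<^esub> f = - f"
    proof (rule group.inv_equality[OF abelian_group.a_group[OF ab]])
      show "f \<in> carrier (add_monoid M)" "- f \<in> carrier (add_monoid M)"
        using f \<open>- f \<in> _\<close> direct_sum_comp_subset[of N, OF N0] by (auto simp: M)
    qed (simp add: M)
    ultimately show "inv\<^bsub>add_monoid M\<^esub> f \<in> direct_sum_comp N d k" by simp
  next
    fix f g assume "f \<in> direct_sum_comp N d k" "g \<in> direct_sum_comp N d k"
    then obtain s t where "f = single k s" "s \<in> N k" "homogeneous d s"
      "g = single k t" "t \<in> N k" "homogeneous d t" by (auto simp: direct_sum_comp_def)
    moreover from this have "homogeneous d (s + t)" "s + t \<in> N k"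
      using keys_add[of s t] by (auto simp: homogeneous_def N intro: ideal_gen_add)
    ultimately show "f \<otimes>\<^bsub>add_monoid M\<^esub> g \<in> direct_sum_comp N d k"
      by (auto simp: M direct_sum_comp_def single_add[symmetric])
  qed
next
  have N0: "0 \<in> N k" for k by (simp add: N ideal_gen_0)
  have restr: "restrict_keys P f \<in> N k" if "f \<in> N k" for P f k
    using that by (auto simp: N ideal_gen_monomials keys_restrict_keys)
  have mon: "abelian_monoid M"
    using abelian_group_direct_sum[OF N M] by (rule abelian_group.axioms)
  have finsum: "(\<Oplus>\<^bsub>M\<^esub>p\<in>X. c p) = (\<Sum>p\<in>X. c p)"
    if "\<And>d k. c (d, k) \<in> direct_sum_comp N d k" for c and X :: "(nat \<times> nat) set"
    by (rule finsum_eq_sum[OF mon M(2,3)]) (use that direct_sum_comp_subset[of N, OF N0] in \<open>force simp: M\<close>)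
  fix f assume f: "f \<in> carrier M"
  define c where "c = (\<lambda>(d, k). single k (restrict_keys (\<lambda>m. expo_degree m = d) (lookup f k)))"
  have c: "c (d, k) \<in> direct_sum_comp N d k" for d k
    using f by (auto simp: c_def direct_sum_comp_def M direct_sum_def homogeneous_def keys_restrict_keys intro!: restr)
  have fin: "finite {p. c p \<noteq> 0}"
  proof (rule finite_subset)
    show "{p. c p \<noteq> 0} \<subseteq> (\<Union>k\<in>keys f. (\<lambda>m. (expo_degree m, k)) ` keys (lookup f k))"
    proof clarify
      fix d k assume "c (d, k) \<noteq> 0"
      then have "restrict_keys (\<lambda>m. expo_degree m = d) (lookup f k) \<noteq> 0" by (auto simp: c_def)
      then obtain m where "m \<in> keys (restrict_keys (\<lambda>m. expo_degree m = d) (lookup f k))"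
        by (metis keys_eq_empty all_not_in_conv)
      then have "m \<in> keys (lookup f k)" "expo_degree m = d" by (auto simp: keys_restrict_keys)
      moreover from this have "k \<in> keys f" by (auto simp: in_keys_iff)
      ultimately show "(d, k) \<in> (\<Union>k\<in>keys f. (\<lambda>m. (expo_degree m, k)) ` keys (lookup f k))" by blast
    qed
  qed auto
  have f_eq: "f = (\<Sum>p\<in>{p. c p \<noteq> 0}. c p)"
    by (intro poly_mapping_eqI, subst lookup_lookup_sum_components[OF c fin])
      (simp add: c_def lookup_restrict_keys)
  show "\<exists>!c. (\<forall>d k. c (d, k) \<in> direct_sum_comp N d k) \<and> finite {p. c p \<noteq> \<zero>\<^bsub>M\<^esub>} \<and>
          f = (\<Oplus>\<^bsub>M\<^esub>p\<in>{p. c p \<noteq> \<zero>\<^bsub>M\<^esub>}. c p)"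
  proof (rule ex1I[of _ c])
    show "(\<forall>d k. c (d, k) \<in> direct_sum_comp N d k) \<and> finite {p. c p \<noteq> \<zero>\<^bsub>M\<^esub>} \<and>
          f = (\<Oplus>\<^bsub>M\<^esub>p\<in>{p. c p \<noteq> \<zero>\<^bsub>M\<^esub>}. c p)"
      using c fin f_eq by (simp add: M finsum[OF c])
  next
    fix c' assume "(\<forall>d k. c' (d, k) \<in> direct_sum_comp N d k) \<and> finite {p. c' p \<noteq> \<zero>\<^bsub>M\<^esub>} \<and>
          f = (\<Oplus>\<^bsub>M\<^esub>p\<in>{p. c' p \<noteq> \<zero>\<^bsub>M\<^esub>}. c' p)"
    then have c': "\<And>d k. c' (d, k) \<in> direct_sum_comp N d k" and fin': "finite {p. c' p \<noteq> 0}"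
      and f_eq': "f = (\<Sum>p\<in>{p. c' p \<noteq> 0}. c' p)"
      by (auto simp: M finsum)
    have *: "lookup (lookup (c' (expo_degree m, k)) k) m = lookup (lookup (c (expo_degree m, k)) k) m" for m k
      using lookup_lookup_sum_components[OF c fin, of k m] lookup_lookup_sum_components[OF c' fin', of k m]
      unfolding f_eq[symmetric] f_eq'[symmetric] by simp
    show "c' = c"
    proof (rule ext, clarify)
      fix d k
      obtain s s' where s: "c (d, k) = single k s" "homogeneous d s" "c' (d, k) = single k s'" "homogeneous d s'"
        using c[of d k] c'[of d k] by (auto simp: direct_sum_comp_def)
      have "lookup s' m = lookup s m" for m
      proof (cases "expo_degree m = d")
        case True
        with *[of m k] s show ?thesis by simp
      next
        case False
        with s have "m \<notin> keys s" "m \<notin> keys s'" by (auto simp: homogeneous_def)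
        then show ?thesis by (simp add: in_keys_iff)
      qed
      then have "s' = s" by (rule poly_mapping_eqI)
      with s show "c' (d, k) = c (d, k)" by simp
    qed
  qed
qed

text \<open>Three families serve two purposes: all equal to the powers of \<open>I\<close> for the
  product of the Rees algebra, and \<open>N' = N''\<close> equal to the shift ideals for its
  action.\<close>

lemma times_mem_direct_sum:
  fixes f g :: "('x, 'k::field) poly_ring_t"
  assumes "f \<in> direct_sum N" "g \<in> direct_sum N'"
    and "\<And>k l s t. s \<in> N k \<Longrightarrow> t \<in> N' l \<Longrightarrow> s * t \<in> N'' (k + l)"
    and "\<And>k. N'' k = ideal_gen (G k)"
  shows "f * g \<in> direct_sum N''"
proof -
  have "f * g = (\<Sum>k\<in>keys f. \<Sum>l\<in>keys g. single (k + l) (lookup f k * lookup g l))"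
    by (subst (1) poly_mapping_sum_single[of f, symmetric], subst (1) poly_mapping_sum_single[of g, symmetric])
      (simp add: sum_product mult_single)
  moreover have "lookup (single (k + l) (lookup f k * lookup g l)) j \<in> N'' j" for k l j
    using assms by (auto simp: lookup_single when_def direct_sum_def intro: ideal_gen_0)
  ultimately show ?thesis
    by (auto simp: direct_sum_def lookup_sum assms(4) intro!: ideal_gen_sum)
qed

lemma times_mem_direct_sum_comp:
  fixes f g :: "('x::finite, 'k::field) poly_ring_t"
  assumes "f \<in> direct_sum_comp N d k" "g \<in> direct_sum_comp N' e l"
    and "\<And>k l s t. s \<in> N k \<Longrightarrow> t \<in> N' l \<Longrightarrow> s * t \<in> N'' (k + l)"
  shows "f * g \<in> direct_sum_comp N'' (d + e) (k + l)"
proof -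
  obtain s t where st: "f = single k s" "s \<in> N k" "homogeneous d s"
    "g = single l t" "t \<in> N' l" "homogeneous e t"
    using assms by (auto simp: direct_sum_comp_def)
  have "homogeneous (d + e) (s * t)"
    using st keys_mult[of s t] by (fastforce simp: homogeneous_def expo_degree_add)
  with st assms(3) show ?thesis by (auto simp: direct_sum_comp_def mult_single)
qed

lemma bigraded_ring_rees_algebra:
  fixes G :: "'x::finite expo set"
  defines "I \<equiv> ideal_gen (monomial ` G) :: ('x, 'k::field) poly_ring set"
  shows "bigraded_ring (rees_algebra I) (rees_comp I)"
proof -
  have pow: "ideal_power I k = ideal_gen (monomial ` nsums G k)" for k
    by (simp add: I_def ideal_power_monomials)
  have times: "s * t \<in> ideal_power I (k + l)" if "s \<in> ideal_power I k" "t \<in> ideal_power I l" for s t k l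
    using times_mem_monomials[of "nsums G k" "nsums G l" "nsums G (k + l)"] nsums_add that unfolding pow by blast
  note M = rees_algebra_def
  have group: "bigraded_group (rees_algebra I) (rees_comp I)"
    unfolding rees_comp_def by (rule bigraded_group_direct_sum[OF pow]) (simp_all add: M)
  have one: "1 \<in> rees_comp I 0 0"
    by (auto simp: rees_comp_def direct_sum_comp_def homogeneous_def expo_degree_def intro!: exI[of _ 1] single_one[symmetric])
  have "cring (rees_algebra I)"
  proof (rule cringI)
    show "abelian_group (rees_algebra I)" using group by (simp add: bigraded_group_def)
    show "comm_monoid (rees_algebra I)"
    proof (rule comm_monoidI)
      show "\<one>\<^bsub>rees_algebra I\<^esub> \<in> carrier (rees_algebra I)"
        using one direct_sum_comp_subset[of "ideal_power I" 0 0]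
        by (auto simp: M rees_comp_def pow ideal_gen_0)
    qed (auto simp: M ac_simps intro: times_mem_direct_sum[where N = "ideal_power I" and N' = "ideal_power I" and N'' = "ideal_power I",
      OF _ _ times pow])
  qed (auto simp: M algebra_simps)
  then show ?thesis
    unfolding bigraded_ring_def using group one
    by (auto simp: M rees_comp_def intro: times_mem_direct_sum_comp[where N = "ideal_power I" and N' = "ideal_power I" and N'' = "ideal_power I",
      OF _ _ times])
qed

section \<open>Comparison of graded free resolutions\<close>

lemma lookup_scal: "lookup (scal s v) b = s * lookup v b"
  by (simp add: scal_def Poly_Mapping.map.rep_eq when_def)

lemma keys_scal: "keys (scal s v) \<subseteq> keys v"
  by (auto simp: in_keys_iff lookup_scal)

lemma module_scal: "Modules.module (scal :: ('x, 'k::field) poly_ring \<Rightarrow> _)"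
  by unfold_locales (rule poly_mapping_eqI, simp add: lookup_scal lookup_add algebra_simps)+

lemma free_vec_expansion: "(\<Sum>b\<in>keys v. scal (lookup v b) (single b 1)) = v"
  by (rule poly_mapping_eqI) (auto simp: lookup_sum lookup_scal lookup_single when_def in_keys_iff if_distrib cong: if_cong)

lemma module_hom_scal_expansion:
  assumes "module_hom scal sc T"
  shows "T v = (\<Sum>b\<in>keys v. sc (lookup v b) (T (single b 1)))"
proof -
  have "T v = T (\<Sum>b\<in>keys v. scal (lookup v b) (single b 1))" by (simp add: free_vec_expansion)
  then show ?thesis by (simp add: module_hom.sum[OF assms] module_hom.scale[OF assms])
qed

lemma module_hom_scal_eqI:
  assumes "module_hom scal sc T" "module_hom scal sc U"
    and "\<And>b. b \<in> basis F i \<Longrightarrow> T (single b 1) = U (single b 1)" "v \<in> tensor F i J"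
  shows "T v = U v"
  unfolding module_hom_scal_expansion[OF assms(1), of v] module_hom_scal_expansion[OF assms(2), of v]
  by (rule sum.cong) (use assms(3,4) in \<open>auto simp: tensor_def\<close>)

text \<open>The linear map with prescribed values on unit vectors. It is linear on the whole ambient
  type, as the notion of resolution demands; values of \<open>\<phi>\<close> outside a given basis
  may be arbitrary.\<close>

definition lin_ext :: "(nat \<Rightarrow> ('x, 'k::field) free_vec) \<Rightarrow> ('x, 'k) free_vec \<Rightarrow> ('x, 'k) free_vec" where
  "lin_ext \<phi> v = (\<Sum>b\<in>keys v. scal (lookup v b) (\<phi> b))"

lemma lin_ext_superset:
  "finite X \<Longrightarrow> keys v \<subseteq> X \<Longrightarrow> lin_ext \<phi> v = (\<Sum>b\<in>X. scal (lookup v b) (\<phi> b))"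
  unfolding lin_ext_def
  by (rule sum.mono_neutral_left) (auto simp: in_keys_iff module.scale_zero_left[OF module_scal])

lemma module_hom_lin_ext: "module_hom scal scal (lin_ext \<phi>)"
proof -
  have "lin_ext \<phi> (v + w) = lin_ext \<phi> v + lin_ext \<phi> w" for v w
    using keys_add[of v w]
    by (simp add: lin_ext_superset[of "keys v \<union> keys w"] lookup_add module.scale_left_distrib[OF module_scal] sum.distrib)
  moreover have "lin_ext \<phi> (scal s v) = scal s (lin_ext \<phi> v)" for s v
  proof -
    show ?thesis
      by (simp add: keys_scal lin_ext_superset[of "keys v"] lookup_scal module.scale_sum_right[OF module_scal]
          module.scale_scale[OF module_scal])
  qed
  ultimately show ?thesis by (simp add: module_hom_iff module_scal)
qed

lemma lin_ext_single: "lin_ext \<phi> (single b 1) = \<phi> b"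
  by (simp add: lin_ext_def module.scale_one[OF module_scal])

lemma tensor_comp_subset: "tensor_comp F i J a \<subseteq> tensor F i J"
  by (auto simp: tensor_comp_def)

lemma tensor_0: "0 \<in> tensor F i (ideal_gen A)"
  by (simp add: tensor_def ideal_gen_0)

lemma tensor_add: "v \<in> tensor F i (ideal_gen A) \<Longrightarrow> w \<in> tensor F i (ideal_gen A) \<Longrightarrow> v + w \<in> tensor F i (ideal_gen A)"
  using keys_add[of v w] by (auto simp: tensor_def lookup_add intro: ideal_gen_add)

lemma tensor_diff: "v \<in> tensor F i (ideal_gen A) \<Longrightarrow> w \<in> tensor F i (ideal_gen A) \<Longrightarrow> v - w \<in> tensor F i (ideal_gen A)"
  using keys_diff[of v w] by (auto simp: tensor_def lookup_minus intro: ideal_gen_diff)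

lemma tensor_sum: "(\<And>x. x \<in> X \<Longrightarrow> f x \<in> tensor F i (ideal_gen A)) \<Longrightarrow> sum f X \<in> tensor F i (ideal_gen A)"
  by (induction X rule: infinite_finite_induct) (auto intro: tensor_0 tensor_add)

lemma tensor_scal: "s \<in> ideal_gen A \<Longrightarrow> v \<in> free_mod F i \<Longrightarrow> scal s v \<in> tensor F i (ideal_gen A)"
  using keys_scal[of s v] by (auto simp: tensor_def lookup_scal mult.commute[of s] intro: ideal_gen_times)

lemma tensor_comp_0: "0 \<in> tensor_comp F i (ideal_gen A) a"
  by (simp add: tensor_comp_def tensor_0)

lemma tensor_comp_add:
  "v \<in> tensor_comp F i (ideal_gen A) a \<Longrightarrow> w \<in> tensor_comp F i (ideal_gen A) a \<Longrightarrow> v + w \<in> tensor_comp F i (ideal_gen A) a"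
  using keys_add[of "lookup v b" "lookup w b" for b] by (fastforce simp: tensor_comp_def lookup_add intro: tensor_add)

lemma tensor_comp_diff:
  "v \<in> tensor_comp F i (ideal_gen A) a \<Longrightarrow> w \<in> tensor_comp F i (ideal_gen A) a \<Longrightarrow> v - w \<in> tensor_comp F i (ideal_gen A) a"
  using keys_diff[of "lookup v b" "lookup w b" for b] by (fastforce simp: tensor_comp_def lookup_minus intro: tensor_diff)

lemma tensor_comp_sum:
  "(\<And>x. x \<in> X \<Longrightarrow> f x \<in> tensor_comp F i (ideal_gen A) a) \<Longrightarrow> sum f X \<in> tensor_comp F i (ideal_gen A) a"
  by (induction X rule: infinite_finite_induct) (auto intro: tensor_comp_0 tensor_comp_add)

lemma tensor_comp_scal:
  assumes "s \<in> ideal_gen A" "\<And>m. m \<in> keys s \<Longrightarrow> m + c = a" "v \<in> tensor_comp F i UNIV c"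
  shows "scal s v \<in> tensor_comp F i (ideal_gen A) a"
  unfolding tensor_comp_def
proof (intro CollectI conjI ballI)
  show "scal s v \<in> tensor F i (ideal_gen A)"
    using assms by (intro tensor_scal) (auto simp: tensor_comp_def)
  fix b m assume b: "b \<in> basis F i" and "m \<in> keys (lookup (scal s v) b)"
  then obtain p q where m: "m = p + q" "p \<in> keys s" "q \<in> keys (lookup v b)"
    using keys_mult[of s "lookup v b"] by (auto simp: lookup_scal)
  then have "q + mdeg F i b = c" using assms(3) b by (auto simp: tensor_comp_def)
  with m assms(2) show "m + mdeg F i b = a" by (simp add: add.assoc)
qed

lemma tensor_single: "b \<in> basis F i \<Longrightarrow> single b 1 \<in> tensor_comp F i UNIV (mdeg F i b)"
  by (auto simp: tensor_comp_def tensor_def lookup_single when_def)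

text \<open>The homological indices \<open>i\<close> and \<open>j\<close> are independent, so that
  differentials, chain maps and homotopies are all instances. Preservation of degrees is required on
  basis vectors and propagates by linearity.\<close>

definition graded_hom ::
    "('x, 'k::field) free_complex \<Rightarrow> nat \<Rightarrow> ('x, 'k) free_complex \<Rightarrow> nat \<Rightarrow>
     (('x, 'k) free_vec \<Rightarrow> ('x, 'k) free_vec) \<Rightarrow> bool" where
  "graded_hom F i G j T \<longleftrightarrow>
     module_hom scal scal T \<and> (\<forall>b\<in>basis F i. T (single b 1) \<in> tensor_comp G j UNIV (mdeg F i b))"

text \<open>The coordinates of \<open>T v\<close> are S-combinations of those of \<open>v\<close>,
  so they stay in the ideal. Hence T tensor J is the restriction of \<open>T\<close>, and maps
  between resolutions act on the complexes computing Tor.\<close>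

lemma graded_hom_tensor_comp:
  assumes "graded_hom F i G j T" "v \<in> tensor_comp F i (ideal_gen A) a"
  shows "T v \<in> tensor_comp G j (ideal_gen A) a"
proof -
  have T: "T v = (\<Sum>b\<in>keys v. scal (lookup v b) (T (single b 1)))"
    using assms(1) by (intro module_hom_scal_expansion) (simp add: graded_hom_def)
  have "scal (lookup v b) (T (single b 1)) \<in> tensor_comp G j (ideal_gen A) a" if "b \<in> keys v" for b
    by (rule tensor_comp_scal[of _ _ "mdeg F i b"])
      (use assms that in \<open>auto simp: graded_hom_def tensor_comp_def tensor_def\<close>)
  then show ?thesis unfolding T by (rule tensor_comp_sum)
qed

lemma graded_hom_free_mod:
  assumes "graded_hom F i G j T" "v \<in> free_mod F i"
  shows "T v \<in> free_mod G j"
proof -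
  have T: "T v = (\<Sum>b\<in>keys v. scal (lookup v b) (T (single b 1)))"
    using assms(1) by (intro module_hom_scal_expansion) (simp add: graded_hom_def)
  have "scal (lookup v b) (T (single b 1)) \<in> tensor G j (ideal_gen {1})" if "b \<in> keys v" for b
    by (rule tensor_scal)
      (use assms that in \<open>auto simp: graded_hom_def tensor_comp_def tensor_def ideal_gen_1\<close>)
  then show ?thesis unfolding T ideal_gen_1[symmetric] by (rule tensor_sum)
qed

lemma graded_hom_compose:
  assumes "graded_hom F i G j T" "graded_hom G j H k U"
  shows "graded_hom F i H k (\<lambda>v. U (T v))"
  unfolding graded_hom_def
proof (intro conjI ballI)
  show "module_hom scal scal (\<lambda>v. U (T v))"
    using module_hom_compose[of scal scal T scal U] assms by (simp add: graded_hom_def o_def)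
  show "U (T (single b 1)) \<in> tensor_comp H k UNIV (mdeg F i b)" if "b \<in> basis F i" for b
    using graded_hom_tensor_comp[OF assms(2), of _ "{1}"] assms(1) that
    by (simp add: ideal_gen_1 graded_hom_def)
qed

lemma graded_hom_diff:
  assumes "graded_hom F i G j T" "graded_hom F i G j U"
  shows "graded_hom F i G j (\<lambda>v. T v - U v)"
  using assms tensor_comp_diff[of _ G j "{1}"]
    module_pair.module_hom_sub[OF module_pair.intro[OF module_scal module_scal], of T U]
  by (auto simp: graded_hom_def ideal_gen_1)

lemma graded_hom_id: "graded_hom F i F i (\<lambda>v. v)"
  using tensor_single by (auto simp: graded_hom_def module.module_hom_ident[OF module_scal])

text \<open>Treats the augmentation as the differential leaving homological degree 0, so that
  exactness of the augmented complex becomes one statement for all \<open>i\<close>.\<close>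

definition aug_cycle :: "('x, 'k::field) free_complex \<Rightarrow> nat \<Rightarrow> ('x, 'k) free_vec \<Rightarrow> bool" where
  "aug_cycle F i v \<longleftrightarrow> (if i = 0 then aug F v = 0 else bd F i v = 0)"

locale resolution =
  fixes F :: "('x, 'k::field) free_complex"
  assumes res: "graded_free_resolution F"
begin

lemma hom_bd: "module_hom scal scal (bd F (Suc i))"
  using res by (simp add: graded_free_resolution_def)

lemma graded_hom_bd: "graded_hom F (Suc i) F i (bd F (Suc i))"
proof -
  have "bd F (Suc i) ` tensor_comp F (Suc i) UNIV a \<subseteq> tensor_comp F i UNIV a" for a
    using res unfolding graded_free_resolution_def by (metis diff_Suc_1 le_add1 plus_1_eq_Suc)
  then show ?thesis using tensor_single unfolding graded_hom_def using hom_bd by blast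
qed

lemma hom_aug: "module_hom scal (\<lambda>s c. lookup s 0 * c) (aug F)"
  using res by (simp add: graded_free_resolution_def)

lemma aug_eq_0:
  assumes "a \<noteq> 0" "v \<in> tensor_comp F 0 UNIV a" shows "aug F v = 0"
proof -
  have "\<forall>a. a \<noteq> 0 \<longrightarrow> aug F ` tensor_comp F 0 UNIV a \<subseteq> {0}"
    using res unfolding graded_free_resolution_def by (elim conjE)
  with assms show ?thesis by auto
qed

lemma exact: "{v \<in> free_mod F i. aug_cycle F i v} = bd F (Suc i) ` free_mod F (Suc i)"
proof -
  have "{v \<in> free_mod F 0. aug F v = 0} = bd F 1 ` free_mod F 1"
    and "\<forall>i\<ge>1. {v \<in> free_mod F i. bd F i v = 0} = bd F (i + 1) ` free_mod F (i + 1)"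
    using res unfolding graded_free_resolution_def by - (elim conjE, assumption)+
  then show ?thesis by (cases "i = 0") (simp_all add: aug_cycle_def)
qed

lemma aug_cycle_bd: "v \<in> free_mod F (Suc i) \<Longrightarrow> aug_cycle F i (bd F (Suc i) v)"
  using exact[of i] by blast

end

section \<open>Multigraded components of vectors, and exactness in each multidegree\<close>

definition degree_part :: "('x, 'k::field) free_complex \<Rightarrow> nat \<Rightarrow> 'x expo \<Rightarrow> ('x, 'k) free_vec \<Rightarrow> ('x, 'k) free_vec" where
  "degree_part F i a v = Poly_Mapping.mapp (\<lambda>b. restrict_keys (\<lambda>m. m + mdeg F i b = a)) v"

lemma restrict_keys_0: "restrict_keys P 0 = 0"
  by (rule poly_mapping_eqI) (simp add: lookup_restrict_keys)

lemma lookup_degree_part: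
  "lookup (degree_part F i a v) b = restrict_keys (\<lambda>m. m + mdeg F i b = a) (lookup v b)"
  by (auto simp: degree_part_def lookup_mapp when_def in_keys_iff restrict_keys_0)

lemma lookup_lookup_degree_part:
  "lookup (lookup (degree_part F i a v) b) m = (if m + mdeg F i b = a then lookup (lookup v b) m else 0)"
  by (simp add: lookup_degree_part lookup_restrict_keys)

lemma degree_part_mem: "v \<in> free_mod F i \<Longrightarrow> degree_part F i a v \<in> tensor_comp F i UNIV a"
  using keys_mapp_subset[of "\<lambda>b. restrict_keys (\<lambda>m. m + mdeg F i b = a)" v]
  by (auto simp: tensor_comp_def tensor_def lookup_degree_part keys_restrict_keys simp flip: degree_part_def)

lemma degree_part_id:
  assumes "v \<in> tensor_comp F i J a" shows "degree_part F i a' v = (if a' = a then v else 0)"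
proof (rule poly_mapping_eqI, rule poly_mapping_eqI)
  fix b m
  show "lookup (lookup (degree_part F i a' v) b) m = lookup (lookup (if a' = a then v else 0) b) m"
  proof (cases "b \<in> keys v \<and> m \<in> keys (lookup v b)")
    case True
    with assms have "m + mdeg F i b = a" by (auto simp: tensor_comp_def tensor_def)
    then show ?thesis by (simp add: lookup_lookup_degree_part)
  next
    case False
    then have "lookup (lookup v b) m = 0" by (auto simp: in_keys_iff)
    then show ?thesis by (simp add: lookup_lookup_degree_part)
  qed
qed

lemma degree_part_0: "degree_part F i a 0 = 0"
  by (rule poly_mapping_eqI)+ (simp add: lookup_lookup_degree_part)

lemma degree_part_add: "degree_part F i a (v + w) = degree_part F i a v + degree_part F i a w"
  by (rule poly_mapping_eqI)+ (simp add: lookup_lookup_degree_part lookup_add)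

lemma degree_part_sum: "degree_part F i a (sum f X) = (\<Sum>x\<in>X. degree_part F i a (f x))"
  by (induction X rule: infinite_finite_induct) (simp_all add: degree_part_0 degree_part_add)

definition degrees :: "('x, 'k::field) free_complex \<Rightarrow> nat \<Rightarrow> ('x, 'k) free_vec \<Rightarrow> 'x expo set" where
  "degrees F i v = (\<Union>b\<in>keys v. (\<lambda>m. m + mdeg F i b) ` keys (lookup v b))"

lemma finite_degrees: "finite (degrees F i v)"
  by (simp add: degrees_def)

lemma sum_degree_parts: "(\<Sum>a\<in>degrees F i v. degree_part F i a v) = v"
proof (rule poly_mapping_eqI, rule poly_mapping_eqI)
  fix b m
  have "m + mdeg F i b \<in> degrees F i v" if "lookup (lookup v b) m \<noteq> 0"
    using that unfolding degrees_def by (intro UN_I[of b] imageI) (auto simp: in_keys_iff)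
  then show "lookup (lookup (\<Sum>a\<in>degrees F i v. degree_part F i a v) b) m = lookup (lookup v b) m"
    by (auto simp: lookup_sum lookup_lookup_degree_part finite_degrees)
qed

text \<open>\<open>T\<close> sends the component of degree \<open>c\<close> into degree
  \<open>c\<close>, so expanding \<open>T v\<close> over the components of \<open>v\<close> leaves
  exactly one summand in degree \<open>a\<close>.\<close>

lemma graded_hom_degree_part:
  assumes T: "graded_hom F i G j T" and v: "v \<in> free_mod F i"
  shows "T (degree_part F i a v) = degree_part G j a (T v)"
proof -
  have hom: "module_hom scal scal T" using T by (simp add: graded_hom_def)
  have mem: "T (degree_part F i c v) \<in> tensor_comp G j UNIV c" for c
    using graded_hom_tensor_comp[OF T, of _ "{1}"] degree_part_mem[OF v] by (simp add: ideal_gen_1)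
  have "T v = T (\<Sum>c\<in>degrees F i v. degree_part F i c v)" by (simp add: sum_degree_parts)
  also have "\<dots> = (\<Sum>c\<in>degrees F i v. T (degree_part F i c v))" by (rule module_hom.sum[OF hom])
  finally have "degree_part G j a (T v) = (\<Sum>c\<in>degrees F i v. degree_part G j a (T (degree_part F i c v)))"
    by (simp add: degree_part_sum)
  also have "\<dots> = (\<Sum>c\<in>degrees F i v. if c = a then T (degree_part F i c v) else 0)"
    by (rule sum.cong) (auto simp: degree_part_id[OF mem])
  also have "\<dots> = T (degree_part F i a v)"
  proof (cases "a \<in> degrees F i v")
    case False
    have "degree_part F i a v = (\<Sum>c\<in>degrees F i v. degree_part F i a (degree_part F i c v))"
      by (subst sum_degree_parts[of F i v, symmetric]) (rule degree_part_sum)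
    also have "\<dots> = (\<Sum>c\<in>degrees F i v. 0)"
      using False by (intro sum.cong) (auto simp: degree_part_id[OF degree_part_mem[OF v]])
    finally have "degree_part F i a v = 0" by simp
    with False show ?thesis by (simp add: finite_degrees module_hom.zero[OF hom])
  qed (simp add: finite_degrees)
  finally show ?thesis by simp
qed

context resolution
begin

text \<open>A resolution is only required to be exact as a complex of ungraded modules. A preimage
  becomes homogeneous by passing to its component of degree \<open>a\<close>, since the differential
  commutes with taking components.\<close>

lemma graded_exact:
  assumes "w \<in> tensor_comp F i UNIV a" "aug_cycle F i w"
  shows "\<exists>u\<in>tensor_comp F (Suc i) UNIV a. bd F (Suc i) u = w"
proof -
  have "w \<in> free_mod F i" using assms by (auto simp: tensor_comp_def)
  with assms(2) have "w \<in> bd F (Suc i) ` free_mod F (Suc i)" unfolding exact[of i, symmetric] by simp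
  then obtain u where u: "u \<in> free_mod F (Suc i)" "bd F (Suc i) u = w" by blast
  have "bd F (Suc i) (degree_part F (Suc i) a u) = degree_part F i a w"
    using graded_hom_degree_part[OF graded_hom_bd u(1)] u(2) by simp
  also have "\<dots> = w" using degree_part_id[OF assms(1)] by simp
  finally show ?thesis using degree_part_mem[OF u(1)] by blast
qed

text \<open>Projectivity of free modules in graded form: homogeneous preimages are chosen on the
  basis and extended linearly. It drives the construction of both chain maps and homotopies.\<close>

lemma lift_graded_hom:
  assumes R: "graded_hom G i F j R" and cyc: "\<And>b. b \<in> basis G i \<Longrightarrow> aug_cycle F j (R (single b 1))"
  shows "\<exists>T. graded_hom G i F (Suc j) T \<and> (\<forall>v\<in>free_mod G i. bd F (Suc j) (T v) = R v)"
proof -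
  have "\<forall>b\<in>basis G i. \<exists>u\<in>tensor_comp F (Suc j) UNIV (mdeg G i b). bd F (Suc j) u = R (single b 1)"
    using R cyc by (auto simp: graded_hom_def intro: graded_exact)
  then obtain \<phi> where \<phi>: "\<And>b. b \<in> basis G i \<Longrightarrow> \<phi> b \<in> tensor_comp F (Suc j) UNIV (mdeg G i b)"
    "\<And>b. b \<in> basis G i \<Longrightarrow> bd F (Suc j) (\<phi> b) = R (single b 1)" by metis
  have T: "graded_hom G i F (Suc j) (lin_ext \<phi>)"
    using \<phi> by (simp add: graded_hom_def module_hom_lin_ext lin_ext_single)
  moreover have "bd F (Suc j) (lin_ext \<phi> v) = R v" if "v \<in> free_mod G i" for v
  proof (rule module_hom_scal_eqI[OF _ _ _ that])
    show "module_hom scal scal (\<lambda>v. bd F (Suc j) (lin_ext \<phi> v))"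
      using graded_hom_compose[OF T graded_hom_bd] by (simp add: graded_hom_def)
  qed (use R \<phi> in \<open>auto simp: graded_hom_def lin_ext_single\<close>)
  ultimately show ?thesis by blast
qed

text \<open>The residue field sits in multidegree 0, so the augmentation of any preimage of
  \<open>c\<close> equals that of its degree 0 component.\<close>

lemma aug_lift: "\<exists>u\<in>tensor_comp F 0 UNIV 0. aug F u = c"
proof -
  have "aug F ` free_mod F 0 = UNIV" using res unfolding graded_free_resolution_def by (elim conjE)
  then obtain u where u: "u \<in> free_mod F 0" "aug F u = c" by (metis UNIV_I image_iff)
  have "aug F u = aug F (\<Sum>a\<in>degrees F 0 u. degree_part F 0 a u)" by (simp add: sum_degree_parts)
  also have "\<dots> = (\<Sum>a\<in>degrees F 0 u. aug F (degree_part F 0 a u))"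
    by (rule module_hom.sum[OF hom_aug])
  also have "\<dots> = (\<Sum>a\<in>degrees F 0 u. if a = 0 then aug F (degree_part F 0 0 u) else 0)"
    using aug_eq_0 degree_part_mem[OF u(1)] by (intro sum.cong) auto
  also have "\<dots> = (if 0 \<in> degrees F 0 u then aug F (degree_part F 0 0 u) else 0)"
    by (simp add: finite_degrees)
  finally show ?thesis
    using u(2) degree_part_mem[OF u(1)] tensor_comp_0[of F 0 "{1}" 0] module_hom.zero[OF hom_aug]
    by (auto simp: ideal_gen_1 split: if_splits)
qed

end

section \<open>Comparison maps, homotopies and independence of Tor of the resolution\<close>

definition chain_map :: "('x, 'k::field) free_complex \<Rightarrow> ('x, 'k) free_complex \<Rightarrow>
    (nat \<Rightarrow> ('x, 'k) free_vec \<Rightarrow> ('x, 'k) free_vec) \<Rightarrow> bool" where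
  "chain_map F G \<phi> \<longleftrightarrow>
     (\<forall>i. graded_hom F i G i (\<phi> i)) \<and> (\<forall>v\<in>free_mod F 0. aug G (\<phi> 0 v) = aug F v) \<and>
     (\<forall>i. \<forall>v\<in>free_mod F (Suc i). bd G (Suc i) (\<phi> (Suc i) v) = \<phi> i (bd F (Suc i) v))"

lemma chain_map_exists:
  assumes "graded_free_resolution F" "graded_free_resolution G"
  shows "\<exists>\<phi>. chain_map F G \<phi>"
proof -
  interpret F: resolution F by unfold_locales fact
  interpret G: resolution G by unfold_locales fact
  \<comment> \<open>The last conjunct, preservation of cycles of the augmented complex, is what
    makes the next lift possible.\<close>
  let ?P = "\<lambda>i T. graded_hom F i G i T \<and> (i = 0 \<longrightarrow> (\<forall>v\<in>free_mod F 0. aug G (T v) = aug F v)) \<and>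
    (\<forall>v\<in>free_mod F i. aug_cycle F i v \<longrightarrow> aug_cycle G i (T v))"
  let ?Q = "\<lambda>i T T'. \<forall>v\<in>free_mod F (Suc i). bd G (Suc i) (T' v) = T (bd F (Suc i) v)"
  have base: "\<exists>T. ?P 0 T"
  proof -
    have "\<exists>u\<in>tensor_comp G 0 UNIV (mdeg F 0 b). aug G u = aug F (single b 1)" if b: "b \<in> basis F 0" for b
    \<comment> \<open>A basis vector of nonzero multidegree is killed by the augmentation and may be
      sent to 0; only multidegree 0 calls for an actual preimage.\<close>
    proof (cases "mdeg F 0 b = 0")
      case True
      then show ?thesis using G.aug_lift by simp
    next
      case False
      then have "aug F (single b 1) = 0" using F.aug_eq_0 tensor_single[OF b] by blast
      then show ?thesis
        using tensor_comp_0[of G 0 "{1}" "mdeg F 0 b"] module_hom.zero[OF G.hom_aug]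
        by (intro bexI[of _ 0]) (auto simp: ideal_gen_1)
    qed
    then obtain \<phi> where \<phi>: "\<And>b. b \<in> basis F 0 \<Longrightarrow> \<phi> b \<in> tensor_comp G 0 UNIV (mdeg F 0 b)"
      "\<And>b. b \<in> basis F 0 \<Longrightarrow> aug G (\<phi> b) = aug F (single b 1)" by metis
    have "aug G (lin_ext \<phi> v) = aug F v" if "v \<in> free_mod F 0" for v
    proof (rule module_hom_scal_eqI[OF _ F.hom_aug _ that])
      show "module_hom scal (\<lambda>s c. lookup s 0 * c) (\<lambda>v. aug G (lin_ext \<phi> v))"
        using module_hom_compose[OF module_hom_lin_ext G.hom_aug] by (simp add: o_def)
    qed (use \<phi> in \<open>auto simp: lin_ext_single\<close>)
    then have "?P 0 (lin_ext \<phi>)"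
      using \<phi> by (simp add: graded_hom_def module_hom_lin_ext lin_ext_single aug_cycle_def)
    then show ?thesis by blast
  qed
  have step: "\<exists>T'. ?P (Suc i) T' \<and> ?Q i T T'" if P: "?P i T" for i T
  proof -
    have R: "graded_hom F (Suc i) G i (\<lambda>v. T (bd F (Suc i) v))"
      using graded_hom_compose[OF F.graded_hom_bd] P by blast
    have "aug_cycle G i (T (bd F (Suc i) (single b 1)))" if "b \<in> basis F (Suc i)" for b
    proof -
      have e: "single b 1 \<in> free_mod F (Suc i)" using tensor_single[OF that] by (simp add: tensor_comp_def)
      show ?thesis using P graded_hom_free_mod[OF F.graded_hom_bd e] F.aug_cycle_bd[OF e] by blast
    qed
    from G.lift_graded_hom[OF R this] obtain T' where T': "graded_hom F (Suc i) G (Suc i) T'" "?Q i T T'" by blast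
    have "T 0 = 0" using P by (auto simp: graded_hom_def intro: module_hom.zero)
    with T' have "?P (Suc i) T'" by (auto simp: aug_cycle_def)
    with T' show ?thesis by blast
  qed
  obtain \<phi> where "\<forall>i. ?P i (\<phi> i) \<and> ?Q i (\<phi> i) (\<phi> (Suc i))"
    using dependent_nat_choice[of ?P ?Q, OF base step] by (rule exE)
  then show ?thesis unfolding chain_map_def by blast
qed

lemma chain_map_compose:
  assumes "chain_map F G \<phi>" "chain_map G H \<psi>"
  shows "chain_map F H (\<lambda>i v. \<psi> i (\<phi> i v))"
proof -
  have "\<phi> i v \<in> free_mod G i" if "v \<in> free_mod F i" for i v
    using assms(1) that unfolding chain_map_def by (blast intro: graded_hom_free_mod)
  with assms show ?thesis unfolding chain_map_def by (auto intro: graded_hom_compose)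
qed

text \<open>Only the part of a null-homotopy of \<open>id - \<Psi>\<close> that is seen by cycles is recorded.\<close>

lemma homotopy_exists:
  assumes "graded_free_resolution F" "chain_map F F \<Psi>"
  shows "\<exists>h. \<forall>i. graded_hom F i F (Suc i) (h i) \<and>
           (\<forall>v\<in>free_mod F i. i = 0 \<or> bd F i v = 0 \<longrightarrow> bd F (Suc i) (h i v) = v - \<Psi> i v)"
proof -
  interpret F: resolution F by unfold_locales fact
  have \<Psi>: "\<And>i. graded_hom F i F i (\<Psi> i)" "\<And>v. v \<in> free_mod F 0 \<Longrightarrow> aug F (\<Psi> 0 v) = aug F v"
    "\<And>i v. v \<in> free_mod F (Suc i) \<Longrightarrow> bd F (Suc i) (\<Psi> (Suc i) v) = \<Psi> i (bd F (Suc i) v)"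
    using assms(2) unfolding chain_map_def by auto
  have free_single: "single b 1 \<in> free_mod F i" if "b \<in> basis F i" for b i
    using tensor_single[OF that] by (simp add: tensor_comp_def)
  let ?P = "\<lambda>i h. graded_hom F i F (Suc i) h \<and>
    (\<forall>v\<in>free_mod F i. i = 0 \<or> bd F i v = 0 \<longrightarrow> bd F (Suc i) (h v) = v - \<Psi> i v)"
  have base: "\<exists>h. ?P 0 h"
  proof -
    have "graded_hom F 0 F 0 (\<lambda>v. v - \<Psi> 0 v)" by (intro graded_hom_diff graded_hom_id \<Psi>)
    moreover have "aug_cycle F 0 (single b 1 - \<Psi> 0 (single b 1))" if "b \<in> basis F 0" for b
      using \<Psi>(2)[OF free_single[OF that]] by (simp add: aug_cycle_def module_hom.diff[OF F.hom_aug])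
    ultimately show ?thesis using F.lift_graded_hom[of F 0 0 "\<lambda>v. v - \<Psi> 0 v"] by auto
  qed
  have step: "\<exists>h'. ?P (Suc i) h' \<and> True" if P: "?P i h" for i h
  proof -
    \<comment> \<open>The usual recursion \<open>bd h' = id - \<Psi> - h bd\<close>. On the kernel
      of \<open>bd\<close> the last term vanishes, which leaves the recorded equation; that
      \<open>?R\<close> takes values in cycles follows from that equation for \<open>h\<close> at
      the cycle \<open>?w\<close>.\<close>
    let ?R = "\<lambda>v. (v - \<Psi> (Suc i) v) - h (bd F (Suc i) v)"
    have "graded_hom F (Suc i) F (Suc i) ?R"
      using P by (intro graded_hom_diff graded_hom_id \<Psi> graded_hom_compose[OF F.graded_hom_bd]) auto
    moreover have "aug_cycle F (Suc i) (?R (single b 1))" if b: "b \<in> basis F (Suc i)" for b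
    proof -
      let ?w = "bd F (Suc i) (single b 1)"
      have "?w \<in> free_mod F i" by (rule graded_hom_free_mod[OF F.graded_hom_bd free_single[OF b]])
      moreover have "i = 0 \<or> bd F i ?w = 0"
        using F.aug_cycle_bd[OF free_single[OF b]] by (simp add: aug_cycle_def split: if_splits)
      ultimately have "bd F (Suc i) (h ?w) = ?w - \<Psi> i ?w" using P by blast
      then show ?thesis
        using \<Psi>(3)[OF free_single[OF b]] by (simp add: aug_cycle_def module_hom.diff[OF F.hom_bd])
    qed
    ultimately obtain h' where h': "graded_hom F (Suc i) F (Suc (Suc i)) h'"
      "\<forall>v\<in>free_mod F (Suc i). bd F (Suc (Suc i)) (h' v) = ?R v"
      using F.lift_graded_hom[of F "Suc i" "Suc i" ?R] by blast
    have "h 0 = 0" using P by (auto simp: graded_hom_def intro: module_hom.zero)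
    with h' show ?thesis by auto
  qed
  from dependent_nat_choice[of ?P "\<lambda>_ _ _. True", OF base step] show ?thesis by simp
qed

text \<open>With chain maps \<open>\<phi>\<close>, \<open>\<psi>\<close> and a homotopy
  \<open>h\<close>, a cycle \<open>z\<close> differs from its image under \<open>\<psi>\<close>
  after \<open>\<phi>\<close> by the boundary of \<open>h z\<close>. If the image of
  \<open>z\<close> under \<open>\<phi>\<close> bounds \<open>w\<close>, then \<open>z\<close> bounds
  the image of \<open>w\<close> under \<open>\<psi>\<close> plus \<open>h z\<close>, with all
  coordinates still in the ideal.\<close>

lemma tor_comparison:
  assumes F: "graded_free_resolution F" and G: "graded_free_resolution G"
    and "\<not> tor_cycles F i (ideal_gen A) a \<subseteq> tor_boundaries F i (ideal_gen A) a"
  shows "\<not> tor_cycles G i (ideal_gen A) a \<subseteq> tor_boundaries G i (ideal_gen A) a"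
proof
  assume sub: "tor_cycles G i (ideal_gen A) a \<subseteq> tor_boundaries G i (ideal_gen A) a"
  interpret F: resolution F by unfold_locales fact
  obtain z where "z \<in> tor_cycles F i (ideal_gen A) a" "z \<notin> tor_boundaries F i (ideal_gen A) a"
    using assms(3) by blast
  then have z: "z \<in> tensor_comp F i (ideal_gen A) a" "i = 0 \<or> bd F i z = 0"
    "z \<notin> tor_boundaries F i (ideal_gen A) a"
    by (auto simp: tor_cycles_def)
  have zf: "z \<in> free_mod F i" using z(1) by (auto simp: tensor_comp_def tensor_def)
  obtain \<phi> \<psi> where \<phi>: "chain_map F G \<phi>" and \<psi>: "chain_map G F \<psi>"
    using chain_map_exists F G by blast
  obtain h where h: "graded_hom F i F (Suc i) (h i)" "bd F (Suc i) (h i z) = z - \<psi> i (\<phi> i z)"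
    using homotopy_exists[OF F chain_map_compose[OF \<phi> \<psi>]] zf z(2) by blast
  have "\<phi> i z \<in> tor_cycles G i (ideal_gen A) a"
    unfolding tor_cycles_def
  proof (intro CollectI conjI impI)
    show "\<phi> i z \<in> tensor_comp G i (ideal_gen A) a"
      using \<phi> z(1) by (auto simp: chain_map_def intro: graded_hom_tensor_comp)
    assume "1 \<le> i"
    then obtain j where j: "i = Suc j" by (cases i) auto
    have "bd G (Suc j) (\<phi> (Suc j) z) = \<phi> j (bd F (Suc j) z)"
      using \<phi> zf unfolding chain_map_def j by blast
    moreover have "\<phi> j 0 = 0"
      using \<phi> by (auto simp: chain_map_def graded_hom_def intro: module_hom.zero)
    ultimately show "bd G i (\<phi> i z) = 0" using z(2) j by simp
  qed
  with sub obtain w where w: "w \<in> tensor_comp G (Suc i) (ideal_gen A) a" "bd G (Suc i) w = \<phi> i z"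
    unfolding tor_boundaries_def by auto
  let ?u = "\<psi> (Suc i) w + h i z"
  have "?u \<in> tensor_comp F (Suc i) (ideal_gen A) a"
    using \<psi> w(1) z(1) h(1) by (auto simp: chain_map_def intro: graded_hom_tensor_comp tensor_comp_add)
  moreover have "bd F (Suc i) ?u = z"
  proof -
    have "w \<in> free_mod G (Suc i)" using w(1) by (auto simp: tensor_comp_def tensor_def)
    then have "bd F (Suc i) (\<psi> (Suc i) w) = \<psi> i (\<phi> i z)"
      using \<psi> w(2) unfolding chain_map_def by auto
    then show ?thesis using h(2) by (simp add: module_hom.add[OF F.hom_bd])
  qed
  ultimately have "z \<in> bd F (Suc i) ` tensor_comp F (Suc i) (ideal_gen A) a" by (metis imageI)
  with z(3) show False by (simp add: tor_boundaries_def)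
qed

section \<open>The Koszul complex\<close>

text \<open>
  Variables are ordered by, and sets of variables are encoded by, the injection \<open>to_nat\<close> of a finite type.
\<close>

abbreviation subset_code :: "'x::finite set \<Rightarrow> nat" where
  "subset_code \<equiv> to_nat"

definition subset_expo :: "'x::finite set \<Rightarrow> 'x expo" where
  "subset_expo \<sigma> = (\<Sum>x\<in>\<sigma>. single x 1)"

text \<open>The exterior algebra sign of sorting \<open>y\<close> into \<open>\<tau>\<close>, when
  the wedge of \<open>y\<close> with the increasing wedge of \<open>\<tau>\<close> is put in
  increasing order.\<close>

definition koszul_sign :: "'x::finite \<Rightarrow> 'x set \<Rightarrow> 'k::field" where
  "koszul_sign y \<tau> = (- 1) ^ card {z\<in>\<tau>. to_nat z < to_nat y}"

text \<open>Written by target coordinates: the coordinate at \<open>\<tau>\<close> collects what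
  each \<open>insert y \<tau>\<close> sends there on losing \<open>y\<close>. The formula does not
  mention the homological degree, so one map serves as all differentials.\<close>

definition koszul_bd :: "('x::finite, 'k::field) free_vec \<Rightarrow> ('x, 'k) free_vec" where
  "koszul_bd v = (\<Sum>\<tau>\<in>UNIV. single (subset_code \<tau>)
     (\<Sum>y\<in>- \<tau>. single (single y 1) (koszul_sign y \<tau>) * lookup v (subset_code (insert y \<tau>))))"

definition koszul :: "('x::finite, 'k::field) free_complex" where
  "koszul = \<lparr>basis = \<lambda>i. subset_code ` {\<sigma> :: 'x set. card \<sigma> = i}, mdeg = \<lambda>i b. subset_expo (from_nat b),
     bd = \<lambda>i. koszul_bd, aug = \<lambda>v. lookup (lookup v (subset_code ({} :: 'x set))) 0\<rparr>"

lemma koszul_simps: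
  "basis (koszul :: ('x::finite, 'k::field) free_complex) i = subset_code ` {\<sigma> :: 'x set. card \<sigma> = i}"
  "mdeg koszul i (subset_code \<sigma>) = subset_expo \<sigma>"
  "bd koszul i = koszul_bd"
  "aug (koszul :: ('x, 'k) free_complex) v = lookup (lookup v (subset_code ({} :: 'x set))) 0"
  by (simp_all add: koszul_def)

lemma lookup_subset_expo: "lookup (subset_expo \<sigma>) x = (if x \<in> \<sigma> then 1 else 0)"
  by (simp add: subset_expo_def lookup_sum lookup_single when_def)

lemma subset_expo_insert: "y \<notin> \<sigma> \<Longrightarrow> subset_expo (insert y \<sigma>) = single y 1 + subset_expo \<sigma>"
  by (simp add: subset_expo_def)

lemma expo_degree_subset_expo: "expo_degree (subset_expo \<sigma>) = card \<sigma>"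
  by (simp add: expo_degree_sum_UNIV lookup_subset_expo sum.If_cases)

lemma expo_diff_single: "y \<in> keys m \<Longrightarrow> m - single y 1 + single y (1::nat) = m"
  by (rule poly_mapping_eqI) (auto simp: lookup_add lookup_minus lookup_single when_def in_keys_iff)

lemma sum_single_code:
  "lookup (\<Sum>\<tau>\<in>UNIV. single (subset_code \<tau>) (f \<tau>)) b =
     (if b \<in> range (subset_code :: 'x set \<Rightarrow> nat) then f (from_nat b :: 'x::finite set)
      else (0 :: 'b::comm_monoid_add))"
proof (cases "b \<in> range (subset_code :: 'x set \<Rightarrow> nat)")
  case True
  then obtain \<sigma> :: "'x set" where b: "b = subset_code \<sigma>" by blast
  show ?thesis by (simp add: b lookup_sum lookup_single when_def)
next
  case False
  then have "\<And>\<tau> :: 'x set. subset_code \<tau> \<noteq> b" by blast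
  then show ?thesis using False by (simp add: lookup_sum lookup_single when_def)
qed

lemma lookup_koszul_bd:
  "lookup (koszul_bd v) (subset_code \<tau>) =
     (\<Sum>y\<in>- \<tau>. single (single y 1) (koszul_sign y \<tau>) * lookup v (subset_code (insert y \<tau>)))"
  by (simp add: koszul_bd_def sum_single_code)

text \<open>Coordinates over the field itself, with respect to monomials times exterior basis
  vectors. Identities in the Koszul complex become identities of scalars.\<close>

definition kcoeff :: "('x::finite, 'k::field) free_vec \<Rightarrow> 'x set \<Rightarrow> 'x expo \<Rightarrow> 'k" where
  "kcoeff v \<sigma> m = lookup (lookup v (subset_code \<sigma>)) m"

lemma koszul_free_mod_iff:
  fixes v :: "('x::finite, 'k::field) free_vec"
  shows "v \<in> free_mod koszul i \<longleftrightarrow>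
    keys v \<subseteq> range (subset_code :: 'x set \<Rightarrow> nat) \<and> (\<forall>\<sigma> m. kcoeff v \<sigma> m \<noteq> 0 \<longrightarrow> card \<sigma> = i)"
proof
  assume v: "v \<in> free_mod koszul i"
  have "card \<sigma> = i" if "kcoeff v \<sigma> m \<noteq> 0" for \<sigma> m
  proof -
    have "subset_code \<sigma> \<in> keys v" using that by (auto simp: kcoeff_def in_keys_iff)
    with v show ?thesis by (auto simp: tensor_def koszul_simps)
  qed
  with v show "keys v \<subseteq> range (subset_code :: 'x set \<Rightarrow> nat) \<and> (\<forall>\<sigma> m. kcoeff v \<sigma> m \<noteq> 0 \<longrightarrow> card \<sigma> = i)"
    by (auto simp: tensor_def koszul_simps)
next
  assume *: "keys v \<subseteq> range (subset_code :: 'x set \<Rightarrow> nat) \<and> (\<forall>\<sigma> m. kcoeff v \<sigma> m \<noteq> 0 \<longrightarrow> card \<sigma> = i)"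
  have "b \<in> basis (koszul :: ('x, 'k) free_complex) i" if b: "b \<in> keys v" for b
  proof -
    obtain \<sigma> :: "'x set" where \<sigma>: "b = subset_code \<sigma>" using * b by blast
    obtain m where "kcoeff v \<sigma> m \<noteq> 0"
      using b unfolding kcoeff_def \<sigma> in_keys_iff by (metis lookup_zero poly_mapping_eqI)
    then have "card \<sigma> = i" using * by blast
    then show ?thesis by (simp add: \<sigma> koszul_simps)
  qed
  then show "v \<in> free_mod koszul i" by (auto simp: tensor_def)
qed

lemma koszul_tensor_comp_iff:
  fixes v :: "('x::finite, 'k::field) free_vec"
  shows "v \<in> tensor_comp koszul i UNIV a \<longleftrightarrow>
    v \<in> free_mod koszul i \<and> (\<forall>\<sigma> m. kcoeff v \<sigma> m \<noteq> 0 \<longrightarrow> m + subset_expo \<sigma> = a)"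
proof (cases "v \<in> free_mod koszul i")
  case True
  then have card: "card \<sigma> = i" if "kcoeff v \<sigma> m \<noteq> 0" for \<sigma> m
    using that koszul_free_mod_iff by blast
  have "v \<in> tensor_comp koszul i UNIV a \<longleftrightarrow>
      (\<forall>\<sigma> :: 'x set. card \<sigma> = i \<longrightarrow> (\<forall>m\<in>keys (lookup v (subset_code \<sigma>)). m + mdeg (koszul :: ('x, 'k) free_complex) i (subset_code \<sigma>) = a))"
    using True unfolding tensor_comp_def koszul_simps(1) by simp
  also have "\<dots> \<longleftrightarrow> (\<forall>\<sigma> m. kcoeff v \<sigma> m \<noteq> 0 \<longrightarrow> m + subset_expo \<sigma> = a)"
  proof (intro iffI allI impI ballI)
    fix \<sigma> :: "'x set" and m
    assume "\<forall>\<sigma> m. kcoeff v \<sigma> m \<noteq> 0 \<longrightarrow> m + subset_expo \<sigma> = a" and "m \<in> keys (lookup v (subset_code \<sigma>))"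
    then show "m + mdeg (koszul :: ('x, 'k) free_complex) i (subset_code \<sigma>) = a"
      by (simp add: koszul_simps(2) kcoeff_def in_keys_iff)
  next
    fix \<sigma> m
    assume *: "\<forall>\<sigma> :: 'x set. card \<sigma> = i \<longrightarrow> (\<forall>m\<in>keys (lookup v (subset_code \<sigma>)).
      m + mdeg (koszul :: ('x, 'k) free_complex) i (subset_code \<sigma>) = a)" and m: "kcoeff v \<sigma> m \<noteq> 0"
    then have "m \<in> keys (lookup v (subset_code \<sigma>))" by (simp add: kcoeff_def in_keys_iff)
    with * card[OF m] show "m + subset_expo \<sigma> = a" by (simp add: koszul_simps(2))
  qed
  finally show ?thesis using True by simp
next
  case False
  then show ?thesis using tensor_comp_subset by blast
qed

lemma kcoeff_eqI:
  fixes v :: "('x::finite, 'k::field) free_vec"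
  assumes "keys v \<subseteq> range (subset_code :: 'x set \<Rightarrow> nat)" "keys w \<subseteq> range (subset_code :: 'x set \<Rightarrow> nat)"
    and "\<And>\<sigma> m. kcoeff v \<sigma> m = kcoeff w \<sigma> m"
  shows "v = w"
proof (rule poly_mapping_eqI)
  fix b show "lookup v b = lookup w b"
  proof (cases "b \<in> range (subset_code :: 'x set \<Rightarrow> nat)")
    case True
    with assms(3) show ?thesis by (auto simp: kcoeff_def intro!: poly_mapping_eqI)
  next
    case False
    with assms have "b \<notin> keys v" "b \<notin> keys w" by auto
    then show ?thesis by (simp add: in_keys_iff)
  qed
qed

lemma keys_koszul_bd:
  fixes v :: "('x::finite, 'k::field) free_vec"
  shows "keys (koszul_bd v) \<subseteq> range (subset_code :: 'x set \<Rightarrow> nat)"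
proof
  fix b assume "b \<in> keys (koszul_bd v)"
  then have "lookup (koszul_bd v) b \<noteq> 0" by (simp add: in_keys_iff)
  then show "b \<in> range (subset_code :: 'x set \<Rightarrow> nat)"
    unfolding koszul_bd_def sum_single_code by (auto split: if_splits)
qed

text \<open>The guard \<open>y \<in> keys m\<close> expresses divisibility by the variable
  \<open>y\<close>; subtraction of exponents truncates and would otherwise return a spurious
  coefficient.\<close>

lemma kcoeff_koszul_bd:
  fixes v :: "('x::finite, 'k::field) free_vec"
  shows "kcoeff (koszul_bd v) \<tau> m =
     (\<Sum>y\<in>- \<tau>. if y \<in> keys m then koszul_sign y \<tau> * kcoeff v (insert y \<tau>) (m - single y 1) else 0)"
proof -
  have "lookup (single (single y 1) c * f) m = (if y \<in> keys m then c * lookup f (m - single y 1) else 0)"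
    for y and c :: 'k and f
  proof (cases "y \<in> keys m")
    case True
    then have "lookup (single (single y 1) c * f) (single y 1 + (m - single y 1)) = c * lookup f (m - single y 1)"
      by (simp only: lookup_single_times)
    with True show ?thesis by (simp add: add.commute[of "single y (Suc 0)"] expo_diff_single[simplified])
  next
    case False
    then have "m \<noteq> single y 1 + t" for t by (auto simp: in_keys_iff lookup_add)
    with False show ?thesis by (simp add: lookup_single_times_eq_0)
  qed
  then show ?thesis unfolding kcoeff_def lookup_koszul_bd lookup_sum by simp
qed

lemma module_hom_koszul_bd:
  "module_hom scal scal (koszul_bd :: ('x::finite, 'k::field) free_vec \<Rightarrow> ('x, 'k) free_vec)"
proof -
  have "koszul_bd (v + w) = koszul_bd v + koszul_bd w" for v w :: "('x, 'k) free_vec"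
    by (rule poly_mapping_eqI) (simp add: koszul_bd_def sum_single_code lookup_add distrib_left sum.distrib)
  moreover have "koszul_bd (scal s v) = scal s (koszul_bd v)" for s and v :: "('x, 'k) free_vec"
    by (rule poly_mapping_eqI)
      (simp add: koszul_bd_def sum_single_code lookup_scal sum_distrib_left mult.left_commute[of s])
  ultimately show ?thesis by (simp add: module_hom_iff module_scal)
qed

text \<open>The terms cancel in pairs by induction on \<open>A\<close>. Deducing that the sum equals
  its own negative would say nothing in characteristic 2.\<close>

lemma sum_antisymmetric_eq_0:
  fixes P :: "'a \<Rightarrow> 'a \<Rightarrow> 'b::ab_group_add"
  assumes "finite A" "\<And>y z. y \<in> A \<Longrightarrow> z \<in> A \<Longrightarrow> y \<noteq> z \<Longrightarrow> P y z = - P z y"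
  shows "(\<Sum>y\<in>A. \<Sum>z\<in>A - {y}. P y z) = 0"
  using assms
proof (induction A)
  case (insert a A)
  have IH: "(\<Sum>y\<in>A. \<Sum>z\<in>A - {y}. P y z) = 0" by (rule insert.IH) (rule insert.prems; simp)
  have "(\<Sum>z\<in>insert a A - {y}. P y z) = P y a + (\<Sum>z\<in>A - {y}. P y z)" if "y \<in> A" for y
  proof -
    have "insert a A - {y} = insert a (A - {y})" using insert.hyps that by auto
    then show ?thesis using insert.hyps by simp
  qed
  moreover have "insert a A - {a} = A" using insert.hyps by auto
  ultimately have "(\<Sum>y\<in>insert a A. \<Sum>z\<in>insert a A - {y}. P y z) =
      (\<Sum>y\<in>A. P a y + P y a) + (\<Sum>y\<in>A. \<Sum>z\<in>A - {y}. P y z)"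
    using insert.hyps by (simp add: sum.distrib)
  also have "(\<Sum>y\<in>A. P a y + P y a) = 0"
  proof (rule sum.neutral, rule ballI)
    fix y assume "y \<in> A"
    with insert.hyps have "P a y = - P y a" by (intro insert.prems) auto
    then show "P a y + P y a = 0" by simp
  qed
  finally show ?case by (simp only: IH add_0)
qed simp

lemma koszul_sign_insert:
  assumes "y \<notin> \<tau>"
  shows "koszul_sign z (insert y \<tau>) = (if to_nat y < to_nat z then - koszul_sign z \<tau> else koszul_sign z \<tau>)"
proof -
  have "{w \<in> insert y \<tau>. to_nat w < to_nat z} =
      (if to_nat y < to_nat z then insert y {w\<in>\<tau>. to_nat w < to_nat z} else {w\<in>\<tau>. to_nat w < to_nat z})"
    by auto
  with assms show ?thesis by (simp add: koszul_sign_def)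
qed

text \<open>\<open>P y z\<close> is the contribution of removing the two variables in one of the two
  orders. Exactly one of \<open>y\<close>, \<open>z\<close> precedes the other, so exactly one of
  the two signs changes on insertion and the orders cancel.\<close>

lemma koszul_bd_bd:
  fixes v :: "('x::finite, 'k::field) free_vec"
  shows "koszul_bd (koszul_bd v) = 0"
proof (rule kcoeff_eqI)
  fix \<tau> :: "'x set" and m
  define P where "P y z = single (single y 1) (koszul_sign y \<tau>) *
    (single (single z 1) (koszul_sign z (insert y \<tau>)) * lookup v (subset_code (insert z (insert y \<tau>))))" for y z
  have anti: "P y z = - P z y" if yz: "y \<in> - \<tau>" "z \<in> - \<tau>" "y \<noteq> z" for y z
  proof -
    have "koszul_sign y \<tau> * koszul_sign z (insert y \<tau>) = - (koszul_sign z \<tau> * koszul_sign y (insert z \<tau>) :: 'k)"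
      using yz by (cases "to_nat y < to_nat z") (auto simp: koszul_sign_insert not_less le_less)
    then show ?thesis
      by (simp add: P_def mult.assoc[symmetric] mult_single insert_commute[of y z] add.commute[of "single y _"]
          single_uminus)
  qed
  have "(\<Sum>y\<in>- \<tau>. \<Sum>z\<in>- \<tau> - {y}. P y z) = 0"
    by (rule sum_antisymmetric_eq_0[OF finite anti])
  moreover have "- insert y \<tau> = - \<tau> - {y}" for y by auto
  ultimately have "lookup (koszul_bd (koszul_bd v)) (subset_code \<tau>) = 0"
    by (simp add: lookup_koszul_bd sum_distrib_left P_def)
  then show "kcoeff (koszul_bd (koszul_bd v)) \<tau> m = kcoeff 0 \<tau> m" by (simp add: kcoeff_def)
qed (simp_all add: keys_koszul_bd)

section \<open>Contraction of the Koszul complex and its exactness\<close>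

definition first_var :: "'x::finite expo \<Rightarrow> 'x" where
  "first_var a = (ARG_MIN to_nat x. x \<in> keys a)"

lemma first_var:
  assumes "a \<noteq> 0"
  shows "first_var a \<in> keys a" "y \<in> keys a \<Longrightarrow> y \<noteq> first_var a \<Longrightarrow> to_nat (first_var a) < to_nat y"
proof -
  obtain z where "z \<in> keys a" using assms by (metis keys_eq_empty all_not_in_conv)
  from arg_min_nat_lemma[of "\<lambda>x. x \<in> keys a" z to_nat, OF this]
  have *: "first_var a \<in> keys a" "\<And>y. y \<in> keys a \<Longrightarrow> to_nat (first_var a) \<le> to_nat y"
    by (auto simp: first_var_def)
  then show "first_var a \<in> keys a" by blast
  assume "y \<in> keys a" "y \<noteq> first_var a"
  then have "to_nat (first_var a) \<noteq> to_nat y" by simp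
  with *(2)[OF \<open>y \<in> keys a\<close>] show "to_nat (first_var a) < to_nat y" by linarith
qed

text \<open>
  A contraction of the Koszul complex away from multidegree \<open>0\<close>: in multidegree \<open>a\<close>, move the first
  variable of \<open>a\<close> from the monomial into the exterior part.
\<close>

definition contraction_coeff :: "('x::finite, 'k::field) free_vec \<Rightarrow> 'x set \<Rightarrow> 'x expo \<Rightarrow> 'k" where
  "contraction_coeff v \<tau> m =
     (let x = first_var (m + subset_expo \<tau>) in
       if m + subset_expo \<tau> \<noteq> 0 \<and> x \<in> \<tau> then kcoeff v (\<tau> - {x}) (m + single x 1) else 0)"

definition contraction :: "('x::finite, 'k::field) free_vec \<Rightarrow> ('x, 'k) free_vec" where
  "contraction v = (\<Sum>\<tau>\<in>UNIV. single (subset_code \<tau>) (Poly_Mapping.Abs_poly_mapping (contraction_coeff v \<tau>)))"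

text \<open>The point is finite support, without which \<open>Abs_poly_mapping\<close> would be
  meaningless: nonzero values only occur at finitely many shifts of supports of coordinates of
  \<open>v\<close>.\<close>

lemma kcoeff_contraction: "kcoeff (contraction v) \<tau> m = contraction_coeff v \<tau> m"
proof -
  have "{m. contraction_coeff v \<tau> m \<noteq> 0} \<subseteq>
      (\<Union>x\<in>UNIV. (\<lambda>m. m - single x 1) ` keys (lookup v (subset_code (\<tau> - {x}))))"
  proof
    fix m assume m: "m \<in> {m. contraction_coeff v \<tau> m \<noteq> 0}"
    define x where "x = first_var (m + subset_expo \<tau>)"
    from m have "m + single x 1 \<in> keys (lookup v (subset_code (\<tau> - {x})))"
      by (auto simp: contraction_coeff_def x_def Let_def kcoeff_def in_keys_iff split: if_splits)
    moreover have "m = (m + single x 1) - single x 1" by simp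
    ultimately show "m \<in> (\<Union>x\<in>UNIV. (\<lambda>m. m - single x 1) ` keys (lookup v (subset_code (\<tau> - {x}))))" by blast
  qed
  then have "finite {m. contraction_coeff v \<tau> m \<noteq> 0}"
    by (rule finite_subset) auto
  then show ?thesis by (simp add: kcoeff_def contraction_def sum_single_code)
qed

lemma keys_contraction:
  fixes v :: "('x::finite, 'k::field) free_vec"
  shows "keys (contraction v) \<subseteq> range (subset_code :: 'x set \<Rightarrow> nat)"
proof
  fix b assume "b \<in> keys (contraction v)"
  then have "lookup (contraction v) b \<noteq> 0" by (simp add: in_keys_iff)
  then show "b \<in> range (subset_code :: 'x set \<Rightarrow> nat)"
    unfolding contraction_def sum_single_code by (auto split: if_splits)
qed

lemma contraction_free_mod:
  assumes "v \<in> free_mod koszul i"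
  shows "contraction v \<in> free_mod koszul (Suc i)"
  unfolding koszul_free_mod_iff
proof (intro conjI keys_contraction allI impI)
  fix \<tau> m assume "kcoeff (contraction v) \<tau> m \<noteq> 0"
  then obtain x where "x \<in> \<tau>" "kcoeff v (\<tau> - {x}) (m + single x 1) \<noteq> 0"
    by (auto simp: kcoeff_contraction contraction_coeff_def Let_def split: if_splits)
  with assms have "x \<in> \<tau>" "card (\<tau> - {x}) = i" unfolding koszul_free_mod_iff by auto
  then show "card \<tau> = Suc i" by (metis card_Suc_Diff1 finite)
qed

text \<open>Let \<open>x\<close> be the first variable of the multidegree. If
  \<open>x \<in> \<sigma>\<close>, the term \<open>y = x\<close> of the contracted boundary is
  \<open>v\<close> itself, and the other terms cancel against the boundary of the contraction. If
  \<open>x \<notin> \<sigma>\<close>, the contracted boundary vanishes and only \<open>y = x\<close>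
  survives in the other summand.\<close>

lemma contraction_homotopy:
  fixes v :: "('x::finite, 'k::field) free_vec"
  assumes "m + subset_expo \<sigma> \<noteq> 0"
  shows "kcoeff (koszul_bd (contraction v)) \<sigma> m + kcoeff (contraction (koszul_bd v)) \<sigma> m = kcoeff v \<sigma> m"
proof -
  define a where "a = m + subset_expo \<sigma>"
  define x where "x = first_var a"
  have x: "x \<in> keys a" "\<And>y. y \<in> keys a \<Longrightarrow> y \<noteq> x \<Longrightarrow> to_nat x < to_nat y"
    using first_var[of a] assms by (auto simp: x_def a_def)
  have keys_a: "keys a = keys m \<union> \<sigma>"
    by (auto simp: a_def in_keys_iff lookup_add lookup_subset_expo)
  have deg: "m - single y 1 + subset_expo (insert y \<sigma>) = a" if "y \<in> - \<sigma>" "y \<in> keys m" for y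
    using that expo_diff_single[of y m] by (simp add: subset_expo_insert a_def add.assoc[symmetric])
  \<comment> \<open>Taking the first variable pays off here: nothing in the exterior part precedes
    \<open>x\<close>, so moving it costs no sign, while its presence flips the sign of every later
    variable.\<close>
  have sign_x: "koszul_sign x \<tau> = (1::'k)" if "\<tau> \<subseteq> \<sigma>" for \<tau>
  proof -
    have "\<not> to_nat z < to_nat x" if "z \<in> \<tau>" for z
      using x(2)[of z] that \<open>\<tau> \<subseteq> \<sigma>\<close> keys_a by (cases "z = x") auto
    then have "{z\<in>\<tau>. to_nat z < to_nat x} = {}" by blast
    then show ?thesis unfolding koszul_sign_def by (simp only: card.empty power_0)
  qed
  have t1: "kcoeff (koszul_bd (contraction v)) \<sigma> m = (\<Sum>y\<in>- \<sigma>. if y \<in> keys m \<and> x \<in> insert y \<sigma> then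
      koszul_sign y \<sigma> * kcoeff v (insert y \<sigma> - {x}) (m - single y 1 + single x 1) else 0)"
    unfolding kcoeff_koszul_bd
  proof (rule sum.cong)
    fix y assume y: "y \<in> - \<sigma>"
    show "(if y \<in> keys m then koszul_sign y \<sigma> * kcoeff (contraction v) (insert y \<sigma>) (m - single y 1) else 0) =
      (if y \<in> keys m \<and> x \<in> insert y \<sigma> then
        koszul_sign y \<sigma> * kcoeff v (insert y \<sigma> - {x}) (m - single y 1 + single x 1) else 0)"
    proof (cases "y \<in> keys m")
      case True
      from assms have "a \<noteq> 0" by (simp add: a_def)
      then show ?thesis
        using True unfolding kcoeff_contraction contraction_coeff_def deg[OF y True] x_def[symmetric] by simp
    qed simp
  qed simp
  show ?thesis
  proof (cases "x \<in> \<sigma>")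
    case True
    have "kcoeff (contraction (koszul_bd v)) \<sigma> m = kcoeff (koszul_bd v) (\<sigma> - {x}) (m + single x 1)"
      using True assms by (simp add: kcoeff_contraction contraction_coeff_def x_def a_def Let_def)
    also have "\<dots> = (\<Sum>y\<in>insert x (- \<sigma>). if y \<in> keys (m + single x 1) then
      koszul_sign y (\<sigma> - {x}) * kcoeff v (insert y (\<sigma> - {x})) (m + single x 1 - single y 1) else 0)"
      unfolding kcoeff_koszul_bd using True by (intro sum.cong) auto
    also have "\<dots> = kcoeff v \<sigma> m + (\<Sum>y\<in>- \<sigma>. if y \<in> keys (m + single x 1) then
      koszul_sign y (\<sigma> - {x}) * kcoeff v (insert y (\<sigma> - {x})) (m + single x 1 - single y 1) else 0)"
      using True by (subst sum.insert) (auto simp: insert_absorb sign_x in_keys_iff lookup_add)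
    also have "(\<Sum>y\<in>- \<sigma>. if y \<in> keys (m + single x 1) then
        koszul_sign y (\<sigma> - {x}) * kcoeff v (insert y (\<sigma> - {x})) (m + single x 1 - single y 1) else 0) =
      - kcoeff (koszul_bd (contraction v)) \<sigma> m"
      unfolding t1 sum_negf[symmetric]
    proof (rule sum.cong)
      fix y assume y: "y \<in> - \<sigma>"
      with True have yx: "y \<noteq> x" by auto
      have keys: "y \<in> keys (m + single x 1) \<longleftrightarrow> y \<in> keys m"
        using yx by (auto simp: in_keys_iff lookup_add lookup_single when_def)
      show "(if y \<in> keys (m + single x 1) then
          koszul_sign y (\<sigma> - {x}) * kcoeff v (insert y (\<sigma> - {x})) (m + single x 1 - single y 1) else 0) =
        - (if y \<in> keys m \<and> x \<in> insert y \<sigma> then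
          koszul_sign y \<sigma> * kcoeff v (insert y \<sigma> - {x}) (m - single y 1 + single x 1) else 0)"
      proof (cases "y \<in> keys m")
        case True
        have "m + single x 1 - single y 1 = m - single y 1 + single x 1"
          using True yx by (intro poly_mapping_eqI) (auto simp: lookup_add lookup_minus lookup_single when_def in_keys_iff)
        moreover have "to_nat x < to_nat y" using x(2)[of y] yx True by (simp add: keys_a)
        then have "koszul_sign y \<sigma> = (- koszul_sign y (\<sigma> - {x}) :: 'k)"
          using koszul_sign_insert[of x "\<sigma> - {x}" y] \<open>x \<in> \<sigma>\<close> by (simp add: insert_absorb)
        moreover have "insert y (\<sigma> - {x}) = insert y \<sigma> - {x}" using yx by auto
        ultimately show ?thesis using True \<open>x \<in> \<sigma>\<close> keys by simp
      next
        case False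
        with keys show ?thesis by simp
      qed
    qed simp
    finally show ?thesis by simp
  next
    case False
    then have xm: "x \<in> keys m" using x(1) by (simp add: keys_a)
    have "kcoeff (contraction (koszul_bd v)) \<sigma> m = 0"
      using False by (simp add: kcoeff_contraction contraction_coeff_def x_def a_def Let_def)
    moreover have "kcoeff (koszul_bd (contraction v)) \<sigma> m = (\<Sum>y\<in>- \<sigma>. if y = x then kcoeff v \<sigma> m else 0)"
      unfolding t1
    proof (rule sum.cong)
      fix y assume "y \<in> - \<sigma>"
      have "insert x \<sigma> - {x} = \<sigma>" using False by auto
      then show "(if y \<in> keys m \<and> x \<in> insert y \<sigma> then
          koszul_sign y \<sigma> * kcoeff v (insert y \<sigma> - {x}) (m - single y 1 + single x 1) else 0) =
        (if y = x then kcoeff v \<sigma> m else 0)"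
        using False xm expo_diff_single[OF xm] by (auto simp: sign_x)
    qed simp
    ultimately show ?thesis using False by simp
  qed
qed

lemma koszul_bd_graded:
  assumes "v \<in> free_mod koszul i" "i \<ge> 1"
  shows "koszul_bd v \<in> free_mod koszul (i - 1)"
    and "v \<in> tensor_comp koszul i UNIV a \<Longrightarrow> koszul_bd v \<in> tensor_comp koszul (i - 1) UNIV a"
proof -
  have *: "\<exists>y. y \<notin> \<tau> \<and> y \<in> keys m \<and> kcoeff v (insert y \<tau>) (m - single y 1) \<noteq> 0"
    if "kcoeff (koszul_bd v) \<tau> m \<noteq> 0" for \<tau> m
  proof (rule ccontr)
    assume "\<not> ?thesis"
    then have "kcoeff (koszul_bd v) \<tau> m = 0" unfolding kcoeff_koszul_bd by (intro sum.neutral) auto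
    with that show False by simp
  qed
  show **: "koszul_bd v \<in> free_mod koszul (i - 1)"
    unfolding koszul_free_mod_iff
  proof (intro conjI keys_koszul_bd allI impI)
    fix \<tau> m assume "kcoeff (koszul_bd v) \<tau> m \<noteq> 0"
    from *[OF this] obtain y where "y \<notin> \<tau>" "card (insert y \<tau>) = i"
      using assms unfolding koszul_free_mod_iff by blast
    then show "card \<tau> = i - 1" by auto
  qed
  assume v: "v \<in> tensor_comp koszul i UNIV a"
  show "koszul_bd v \<in> tensor_comp koszul (i - 1) UNIV a"
    unfolding koszul_tensor_comp_iff
  proof (intro conjI ** allI impI)
    fix \<tau> m assume "kcoeff (koszul_bd v) \<tau> m \<noteq> 0"
    from *[OF this] obtain y where y: "y \<notin> \<tau>" "y \<in> keys m" "m - single y 1 + subset_expo (insert y \<tau>) = a"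
      using v unfolding koszul_tensor_comp_iff by blast
    then have "(m - single y 1 + single y 1) + subset_expo \<tau> = a" by (simp add: subset_expo_insert add.assoc)
    then show "m + subset_expo \<tau> = a" using expo_diff_single[OF y(2)] by simp
  qed
qed

text \<open>The homotopy exhibits \<open>v\<close> as a boundary in all nonzero multidegrees. The
  only coordinate of multidegree 0 is the constant term at the empty set, which is zero by
  assumption and in every boundary.\<close>

lemma koszul_exact:
  fixes v :: "('x::finite, 'k::field) free_vec"
  assumes v: "v \<in> free_mod koszul i" and "koszul_bd v = 0" and "kcoeff v {} 0 = 0"
  shows "koszul_bd (contraction v) = v"
proof (rule kcoeff_eqI[OF keys_koszul_bd])
  fix \<sigma> :: "'x set" and m
  show "kcoeff (koszul_bd (contraction v)) \<sigma> m = kcoeff v \<sigma> m"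
  proof (cases "m + subset_expo \<sigma> = 0")
    case True
    then have "expo_degree m + card \<sigma> = 0"
      by (metis expo_degree_0 expo_degree_add expo_degree_subset_expo)
    then have "m = 0" "\<sigma> = {}" by (auto simp: expo_degree_eq_0)
    with assms(3) show ?thesis by (simp add: kcoeff_koszul_bd)
  next
    case False
    have "kcoeff (contraction (koszul_bd v)) \<sigma> m = 0"
      unfolding assms(2) kcoeff_contraction by (simp add: contraction_coeff_def kcoeff_def Let_def)
    with contraction_homotopy[OF False, of v] show ?thesis by simp
  qed
qed (use v in \<open>simp add: koszul_free_mod_iff\<close>)

lemma koszul_resolution: "graded_free_resolution (koszul :: ('x::finite, 'k::field) free_complex)"
  unfolding graded_free_resolution_def
proof (intro conjI allI impI)
  let ?K = "koszul :: ('x, 'k) free_complex"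
  note aug = koszul_simps(4)
  show "module_hom scal scal (bd ?K i)" for i by (simp add: koszul_simps module_hom_koszul_bd)
  show "bd ?K i ` free_mod ?K i \<subseteq> free_mod ?K (i - 1)" if "1 \<le> i" for i
    using that koszul_bd_graded(1) by (auto simp: koszul_simps)
  show "bd ?K i ` tensor_comp ?K i UNIV a \<subseteq> tensor_comp ?K (i - 1) UNIV a" if "1 \<le> i" for i a
    using that koszul_bd_graded(2) tensor_comp_subset by (fastforce simp: koszul_simps)
  \<comment> \<open>A sum of exponents is 0 only if both are, so taking constant terms is
    multiplicative; this makes the field an S-module.\<close>
  have lookup_times_0: "lookup (s * t) 0 = lookup s 0 * lookup t 0" for s t :: "('x, 'k) poly_ring"
  proof -
    have "s * t = single 0 (lookup s 0) * t + (\<Sum>m\<in>keys s - {0}. single m (lookup s m) * t)"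
      by (subst (1) poly_mapping_sum_single[of s, symmetric])
        (cases "0 \<in> keys s", auto simp: sum.remove[of "keys s" 0] sum_distrib_right distrib_right in_keys_iff)
    moreover have "lookup (single m (lookup s m) * t) 0 = 0" if "m \<noteq> 0" for m
    proof (rule lookup_single_times_eq_0)
      fix u show "0 \<noteq> m + u"
        using that by (metis add_is_0 expo_degree_0 expo_degree_add expo_degree_eq_0)
    qed
    ultimately show ?thesis by (simp add: lookup_add lookup_sum lookup_single_0_times)
  qed
  show "module_hom scal (\<lambda>s c. lookup s 0 * c) (aug ?K)"
  proof -
    have "Modules.module (\<lambda>(s :: ('x, 'k) poly_ring) c. lookup s 0 * c)"
      by unfold_locales (simp_all add: algebra_simps lookup_add lookup_times_0)
    then show ?thesis
      by (auto simp: module_hom_iff module_scal aug lookup_add lookup_scal lookup_times_0)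
  qed
  show "aug ?K ` tensor_comp ?K 0 UNIV a \<subseteq> {0}" if "a \<noteq> 0" for a
  proof clarify
    fix v assume "v \<in> tensor_comp ?K 0 UNIV a"
    then have "kcoeff v {} 0 \<noteq> 0 \<longrightarrow> 0 + subset_expo {} = a" unfolding koszul_tensor_comp_iff by blast
    with that show "aug ?K v = 0" by (auto simp: aug kcoeff_def subset_expo_def)
  qed
  show "aug ?K ` free_mod ?K 0 = UNIV"
  proof -
    have "c \<in> aug ?K ` free_mod ?K 0" for c
    proof (rule image_eqI)
      show "c = aug ?K (single (subset_code ({} :: 'x set)) (single 0 c))" by (simp add: aug)
      show "single (subset_code ({} :: 'x set)) (single 0 c) \<in> free_mod ?K 0"
        by (auto simp: tensor_def koszul_simps)
    qed
    then show ?thesis by blast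
  qed
  show "{v \<in> free_mod ?K 0. aug ?K v = 0} = bd ?K 1 ` free_mod ?K 1"
  proof (intro subset_antisym subsetI)
    fix v assume "v \<in> {v \<in> free_mod ?K 0. aug ?K v = 0}"
    then have v: "v \<in> free_mod ?K 0" "kcoeff v {} 0 = 0" by (auto simp: aug kcoeff_def)
    \<comment> \<open>In homological degree 0 only the empty set carries coordinates, whereas the
      differential reads coordinates at nonempty sets.\<close>
    have "koszul_bd v = 0"
    proof (rule kcoeff_eqI[OF keys_koszul_bd])
      fix \<sigma> :: "'x set" and m
      have "kcoeff v (insert y \<sigma>) m' = 0" for y m'
        using v(1) unfolding koszul_free_mod_iff by (metis card_0_eq finite insert_not_empty)
      then show "kcoeff (koszul_bd v) \<sigma> m = kcoeff 0 \<sigma> m"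
        unfolding kcoeff_koszul_bd by (subst sum.neutral) (simp_all add: kcoeff_def[of 0])
    qed simp
    from koszul_exact[OF v(1) this v(2)] contraction_free_mod[OF v(1)]
    show "v \<in> bd ?K 1 ` free_mod ?K 1" by (auto simp: koszul_simps intro!: image_eqI[OF sym])
  next
    fix v assume "v \<in> bd ?K 1 ` free_mod ?K 1"
    then obtain w where w: "w \<in> free_mod ?K 1" "v = koszul_bd w" by (auto simp: koszul_simps)
    have "kcoeff v {} 0 = 0" by (simp add: w kcoeff_koszul_bd)
    with koszul_bd_graded(1)[OF w(1)] show "v \<in> {v \<in> free_mod ?K 0. aug ?K v = 0}"
      by (simp add: w aug kcoeff_def)
  qed
  fix i :: nat assume i: "1 \<le> i"
  show "{v \<in> free_mod ?K i. bd ?K i v = 0} = bd ?K (i + 1) ` free_mod ?K (i + 1)"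
  proof (intro subset_antisym subsetI)
    fix v assume "v \<in> {v \<in> free_mod ?K i. bd ?K i v = 0}"
    then have v: "v \<in> free_mod ?K i" "koszul_bd v = 0" by (auto simp: koszul_simps)
    have "kcoeff v {} 0 = 0" using v(1) i unfolding koszul_free_mod_iff by force
    from koszul_exact[OF v this] contraction_free_mod[OF v(1)]
    show "v \<in> bd ?K (i + 1) ` free_mod ?K (i + 1)" by (auto simp: koszul_simps intro!: image_eqI[OF sym])
  next
    fix v assume "v \<in> bd ?K (i + 1) ` free_mod ?K (i + 1)"
    then obtain w where w: "w \<in> free_mod ?K (i + 1)" "v = koszul_bd w" by (auto simp: koszul_simps)
    with koszul_bd_graded(1)[OF w(1)] show "v \<in> {v \<in> free_mod ?K i. bd ?K i v = 0}"
      by (simp add: koszul_simps koszul_bd_bd)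
  qed
qed

lemma finite_basis_koszul: "finite (basis koszul i)"
  by (simp add: koszul_simps)

lemma expo_degree_mdeg_koszul:
  fixes K :: "('x::finite, 'k::field) free_complex"
  defines "K \<equiv> koszul"
  shows "b \<in> basis K i \<Longrightarrow> expo_degree (mdeg K i b) = i"
  by (auto simp: K_def koszul_simps(1,2) expo_degree_subset_expo)

section \<open>Dickson's lemma\<close>

text \<open>Induction on the coordinates. A finite \<open>B\<close> that works when \<open>x\<close>
  is ignored also dominates in \<open>x\<close> all \<open>l\<close> with \<open>l x\<close> at
  least a bound \<open>N\<close>; the finitely many slices \<open>l x = c\<close> with
  \<open>c < N\<close> are covered by the induction hypothesis.\<close>

lemma dickson:
  fixes L :: "('a \<Rightarrow> nat) set"
  assumes "finite X"
  shows "\<exists>B. finite B \<and> B \<subseteq> L \<and> (\<forall>l\<in>L. \<exists>b\<in>B. \<forall>x\<in>X. b x \<le> l x)"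
  using assms
proof (induction X arbitrary: L)
  case empty
  show ?case
  proof (cases "L = {}")
    case False
    then obtain l where "l \<in> L" by blast
    then show ?thesis by (intro exI[of _ "{l}"]) auto
  qed auto
next
  case (insert x X)
  obtain B where B: "finite B" "B \<subseteq> L" "\<And>l. l \<in> L \<Longrightarrow> \<exists>b\<in>B. \<forall>x\<in>X. b x \<le> l x"
    using insert.IH[of L] by blast
  have "\<forall>c. \<exists>C. finite C \<and> C \<subseteq> {l \<in> L. l x = c} \<and> (\<forall>l\<in>{l \<in> L. l x = c}. \<exists>b\<in>C. \<forall>x\<in>X. b x \<le> l x)"
    using insert.IH by (intro allI)
  from choice[OF this] obtain C where C: "\<forall>c. finite (C c) \<and> C c \<subseteq> {l \<in> L. l x = c} \<and>
      (\<forall>l\<in>{l \<in> L. l x = c}. \<exists>b\<in>C c. \<forall>x\<in>X. b x \<le> l x)"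
    by (rule exE)
  \<comment> \<open>Any common upper bound of the values \<open>b x\<close> would serve.\<close>
  define N where "N = (\<Sum>b\<in>B. b x)"
  have N: "b x \<le> N" if "b \<in> B" for b
    unfolding N_def using B(1) that by (rule member_le_sum[rotated 2]) auto
  show ?case
  proof (intro exI[of _ "B \<union> (\<Union>c<N. C c)"] conjI ballI)
    show "finite (B \<union> (\<Union>c<N. C c))" using B C by auto
    show "B \<union> (\<Union>c<N. C c) \<subseteq> L" using B(2) C by fast
    fix l assume l: "l \<in> L"
    show "\<exists>b\<in>B \<union> (\<Union>c<N. C c). \<forall>y\<in>insert x X. b y \<le> l y"
    proof (cases "l x < N")
      case True
      have "\<exists>b\<in>C (l x). \<forall>x\<in>X. b x \<le> l x" using C[rule_format, of "l x"] l by simp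
      then obtain b where "b \<in> C (l x)" "\<forall>x\<in>X. b x \<le> l x" by blast
      moreover from this have "b x = l x" using C[rule_format, of "l x"] by auto
      ultimately show ?thesis using True by (intro bexI[of _ b]) auto
    next
      case False
      obtain b where "b \<in> B" "\<forall>x\<in>X. b x \<le> l x" using B(3)[OF l] by blast
      moreover from this have "b x \<le> l x" using N[of b] False by simp
      ultimately show ?thesis by (intro bexI[of _ b]) auto
    qed
  qed
qed

section \<open>Sums of generators counted with multiplicities\<close>

definition nat_mult :: "nat \<Rightarrow> 'a::comm_monoid_add \<Rightarrow> 'a" where
  "nat_mult n g = (\<Sum>j<n. g)"

lemma nat_mult_Suc: "nat_mult (Suc n) g = g + nat_mult n g"
  by (simp add: nat_mult_def add.commute)

lemma nat_mult_add: "nat_mult (m + n) g = nat_mult m g + nat_mult n g"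
  by (induction m) (simp_all add: nat_mult_Suc add.assoc, simp add: nat_mult_def)

text \<open>Replaces a sum by the multiplicities of its summands. These are functions to the natural
  numbers on a finite set, the setting of \<open>dickson\<close>, and their total recovers
  \<open>k\<close>.\<close>

lemma nsums_imp_nat_mult:
  assumes "finite G" "e \<in> nsums G k"
  shows "\<exists>l. k = (\<Sum>g\<in>G. l g) \<and> e = (\<Sum>g\<in>G. nat_mult (l g) g)"
  using assms(2)
proof (induction k arbitrary: e)
  case 0
  then show ?case by (intro exI[of _ "\<lambda>_. 0"]) (simp add: nat_mult_def)
next
  case (Suc k)
  then obtain h e' where e: "e = h + e'" "h \<in> G" "e' \<in> nsums G k" by auto
  with Suc.IH obtain l where l: "k = (\<Sum>g\<in>G. l g)" "e' = (\<Sum>g\<in>G. nat_mult (l g) g)" by blast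
  let ?l = "l(h := Suc (l h))"
  have "(\<Sum>g\<in>G. ?l g) = Suc k" "(\<Sum>g\<in>G. nat_mult (?l g) g) = e"
    using assms(1) e(2) by (simp_all add: sum.remove[of G h] l e(1) nat_mult_Suc add.assoc)
  then show ?case by metis
qed

lemma nat_mult_in_nsums:
  assumes "finite G"
  shows "(\<Sum>g\<in>G. nat_mult (l g) g) \<in> nsums G (\<Sum>g\<in>G. l g)"
proof -
  have *: "nat_mult n g \<in> nsums G n" if "g \<in> G" for n g
    using that by (induction n) (auto simp: nat_mult_Suc, simp add: nat_mult_def)
  have "(\<Sum>g\<in>H. nat_mult (l g) g) \<in> nsums G (\<Sum>g\<in>H. l g)" if "finite H" "H \<subseteq> G" for H
    using that by (induction H) (auto intro: nsums_add *)
  then show ?thesis using assms by blast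
qed

section \<open>The Tor modules of ideals with linear powers\<close>

lemma keys_subset_upset:
  "f \<in> ideal_gen (monomial ` A) \<longleftrightarrow> keys f \<subseteq> upset A"
  by (simp add: ideal_gen_monomials)

text \<open>By comparison, a class that survives in some resolution survives in the Koszul complex;
  the existential quantifier over resolutions disappears.\<close>

lemma tor_nonzero_iff_koszul:
  fixes A :: "('x::finite, 'k::field) poly_ring set"
  shows "tor_nonzero i (ideal_gen A) a \<longleftrightarrow>
    \<not> tor_cycles koszul i (ideal_gen A) a \<subseteq> tor_boundaries koszul i (ideal_gen A) a"
  unfolding tor_nonzero_def using tor_comparison koszul_resolution by blast

lemma koszul_bd_0: "koszul_bd 0 = 0"
  by (rule module_hom.zero[OF module_hom_koszul_bd])

lemma tor_nonzeroE:
  fixes A :: "('x::finite, 'k::field) poly_ring set"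
  assumes "tor_nonzero i (ideal_gen A) a"
  obtains v where "v \<in> tor_cycles koszul i (ideal_gen A) a" "v \<noteq> 0"
proof -
  have "koszul_bd 0 \<in> tor_boundaries koszul i (ideal_gen A) a"
    using tensor_comp_0[of koszul "i + 1" A a] by (auto simp: tor_boundaries_def koszul_simps)
  then have "0 \<in> tor_boundaries koszul i (ideal_gen A) a" by (simp add: koszul_bd_0)
  with assms that show thesis unfolding tor_nonzero_iff_koszul by blast
qed

lemma tensor_comp_key:
  assumes "v \<in> tensor_comp F i (ideal_gen (monomial ` A)) a" "b \<in> keys v"
  shows "b \<in> basis F i" "\<exists>m\<in>upset A. m + mdeg F i b = a"
proof -
  show b: "b \<in> basis F i" using assms by (auto simp: tensor_comp_def tensor_def)
  from assms(2) have "lookup v b \<noteq> 0" by (simp add: in_keys_iff)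
  then obtain m where "m \<in> keys (lookup v b)" by (metis keys_eq_empty all_not_in_conv)
  moreover have "keys (lookup v b) \<subseteq> upset A"
    using assms(1) b by (auto simp: tensor_comp_def tensor_def keys_subset_upset)
  ultimately show "\<exists>m\<in>upset A. m + mdeg F i b = a"
    using assms(1) b by (auto simp: tensor_comp_def)
qed

text \<open>Each term of a homogeneous generator has degree \<open>d\<close>, and its monomial lies
  in \<open>I\<close> because \<open>I\<close> is a monomial ideal. So the monomials of degree
  \<open>d\<close> in \<open>I\<close> already generate it.\<close>

lemma monomial_generators_in_degree:
  assumes "monomial_ideal I" "generated_in_degree d I"
  shows "\<exists>G. (\<forall>g\<in>G. expo_degree g = d) \<and> I = ideal_gen (monomial ` G)"
proof -
  obtain A where A: "I = ideal_gen (monomial ` A)" using assms(1) by (auto simp: monomial_ideal_def)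
  obtain P where P: "\<And>p. p \<in> P \<Longrightarrow> homogeneous d p" "I = ideal_gen P"
    using assms(2) by (auto simp: generated_in_degree_def)
  define G where "G = {g. expo_degree g = d \<and> monomial g \<in> I}"
  have "I \<subseteq> ideal_gen (monomial ` G)"
    unfolding P(2)
  proof (rule ideal_gen_least_gen, rule subsetI)
    fix p assume p: "p \<in> P"
    have pI: "keys p \<subseteq> upset A"
      using ideal_gen_base[OF p] unfolding P(2)[symmetric] A keys_subset_upset .
    have "m \<in> upset G" if m: "m \<in> keys p" for m
    proof -
      have "monomial m \<in> I" using pI m by (auto simp: A keys_subset_upset keys_monomial)
      moreover have "expo_degree m = d" using P(1)[OF p] m by (simp add: homogeneous_def)
      ultimately have "m \<in> G" by (simp add: G_def)
      then show ?thesis unfolding upset_def by (intro CollectI exI[of _ m] exI[of _ 0]) simp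
    qed
    then show "p \<in> ideal_gen (monomial ` G)" by (auto simp: keys_subset_upset)
  qed
  moreover have "ideal_gen (monomial ` G) \<subseteq> I"
    unfolding A by (rule ideal_gen_least_gen) (auto simp: G_def A)
  ultimately show ?thesis by (intro exI[of _ G]) (auto simp: G_def)
qed

section \<open>Tor of the powers of an equigenerated monomial ideal with linear powers\<close>

locale linear_powers_ideal =
  fixes G :: "'x::finite expo set" and d :: nat and I :: "('x, 'k::field) poly_ring set"
  assumes degree_G: "g \<in> G \<Longrightarrow> expo_degree g = d"
    and I_eq: "I = ideal_gen (monomial ` G)"
    and linear: "linear_powers I"
begin

text \<open>Finiteness comes from the common degree of the generators, without an appeal to
  Noetherianity.\<close>

lemma finite_G: "finite G"
  by (rule finite_subset[OF _ finite_expo_degree[of d]]) (auto simp: degree_G)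

lemma power_eq: "ideal_power I k = ideal_gen (monomial ` nsums G k)"
  by (simp add: I_eq ideal_power_monomials)

lemma degree_nsums: "e \<in> nsums G k \<Longrightarrow> expo_degree e = k * d"
  by (induction k arbitrary: e) (auto simp: expo_degree_0 expo_degree_add degree_G)

lemma degree_upset: "m \<in> upset (nsums G k) \<Longrightarrow> k * d \<le> expo_degree m"
  by (auto simp: upset_def expo_degree_add degree_nsums)

text \<open>The degree in \<open>has_linear_resolution\<close> is merely asserted to exist for each
  power, so it must be identified with \<open>k * d\<close>. A nonzero class forces the power to be
  nonzero, and then the two candidate generating degrees bound each other.\<close>

lemma tor_degree:
  assumes "k \<ge> 1" "tor_nonzero i (ideal_power I k) a"
  shows "expo_degree a = i + k * d"
proof -
  obtain d' where d': "generated_in_degree d' (ideal_power I k)" "expo_degree a = i + d'"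
    using linear assms unfolding linear_powers_def has_linear_resolution_def by blast
  obtain P where P: "\<And>p. p \<in> P \<Longrightarrow> homogeneous d' p" "ideal_power I k = ideal_gen P"
    using d'(1) by (auto simp: generated_in_degree_def)
  obtain v where v: "v \<in> tor_cycles koszul i (ideal_power I k) a" "v \<noteq> 0"
    using assms(2) unfolding power_eq by (rule tor_nonzeroE)
  then obtain b where "b \<in> keys v" by (metis keys_eq_empty all_not_in_conv)
  with v(1) obtain m where "m \<in> upset (nsums G k)"
    unfolding tor_cycles_def power_eq using tensor_comp_key(2) by blast
  then obtain e where e: "e \<in> nsums G k" by (auto simp: upset_def)
  then have mem: "monomial e \<in> ideal_gen P"
    unfolding P(2)[symmetric] power_eq by (intro ideal_gen_base) auto
  have "ideal_gen P \<subseteq> {f. \<forall>m\<in>keys f. d' \<le> expo_degree m}"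
  proof (rule ideal_gen_least)
    show "P \<subseteq> {f. \<forall>m\<in>keys f. d' \<le> expo_degree m}" using P(1) by (auto simp: homogeneous_def)
    show "f + g \<in> {f. \<forall>m\<in>keys f. d' \<le> expo_degree m}"
      if "f \<in> {f. \<forall>m\<in>keys f. d' \<le> expo_degree m}" "g \<in> {f. \<forall>m\<in>keys f. d' \<le> expo_degree m}"
      for f g :: "('x, 'k) poly_ring"
      using that keys_add[of f g] by blast
    show "s * f \<in> {f. \<forall>m\<in>keys f. d' \<le> expo_degree m}"
      if f: "f \<in> {f. \<forall>m\<in>keys f. d' \<le> expo_degree m}" for s f :: "('x, 'k) poly_ring"
    proof (intro CollectI ballI)
      fix m assume "m \<in> keys (s * f)"
      then obtain p q where "m = p + q" "q \<in> keys f" using keys_mult[of s f] by blast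
      with f show "d' \<le> expo_degree m" by (auto simp: expo_degree_add intro: trans_le_add2)
    qed
  qed simp
  with mem have "d' \<le> expo_degree e" by (auto simp: keys_monomial)
  \<comment> \<open>A nonzero homogeneous generator has a term of degree \<open>d'\<close>, and that
    term lies above a sum of \<open>k\<close> elements of \<open>G\<close>.\<close>
  moreover have "k * d \<le> d'"
  proof -
    have "\<not> P \<subseteq> {0}"
    proof
      assume "P \<subseteq> {0}"
      then have "ideal_gen P \<subseteq> {0}" by (rule ideal_gen_least) auto
      with mem have "keys (monomial e :: ('x, 'k) poly_ring) = {}" by auto
      then show False by (simp add: keys_monomial)
    qed
    then obtain p where p: "p \<in> P" "p \<noteq> 0" by blast
    then obtain m where m: "m \<in> keys p" by (metis keys_eq_empty all_not_in_conv)
    have "p \<in> ideal_power I k" using p(1) P(2) ideal_gen_base by blast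
    with m have "k * d \<le> expo_degree m"
      by (intro degree_upset) (auto simp: power_eq keys_subset_upset)
    with P(1)[OF p(1)] m show ?thesis by (simp add: homogeneous_def)
  qed
  ultimately show ?thesis using d'(2) degree_nsums[OF e] by simp
qed

lemma tor_cycle:
  assumes "k \<ge> 1" "tor_nonzero i (ideal_power I k) a"
  obtains v where "v \<in> tor_cycles koszul i (ideal_power I k) a" "v \<noteq> 0"
    "\<And>b. b \<in> keys v \<Longrightarrow>
      b \<in> basis (koszul :: ('x, 'k) free_complex) i \<and> (\<exists>e\<in>nsums G k. a = e + mdeg (koszul :: ('x, 'k) free_complex) i b)"
proof -
  let ?K = "koszul :: ('x, 'k) free_complex"
  obtain v where v: "v \<in> tor_cycles ?K i (ideal_power I k) a" "v \<noteq> 0"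
    using assms(2) unfolding power_eq by (rule tor_nonzeroE)
  have "b \<in> basis ?K i \<and> (\<exists>e\<in>nsums G k. a = e + mdeg ?K i b)" if bv: "b \<in> keys v" for b
  proof -
    have vt: "v \<in> tensor_comp ?K i (ideal_gen (monomial ` nsums G k)) a"
      using v(1) by (simp add: tor_cycles_def power_eq)
    have b: "b \<in> basis ?K i" by (rule tensor_comp_key(1)[OF vt bv])
    obtain m where m: "m \<in> upset (nsums G k)" "m + mdeg ?K i b = a"
      using tensor_comp_key(2)[OF vt bv] by blast
    obtain e t where e: "m = e + t" "e \<in> nsums G k" using m(1) by (auto simp: upset_def)
    have "expo_degree m + i = i + k * d"
      using tor_degree[OF assms] expo_degree_mdeg_koszul[OF b]
      unfolding m(2)[symmetric] by (simp add: expo_degree_add)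
    \<comment> \<open>The basis vector accounts for \<open>i\<close> of the total degree
      \<open>i + k * d\<close>, and \<open>e\<close> for all the rest, so no room is left for a
      cofactor.\<close>
    then have "t = 0" using degree_nsums[OF e(2)] by (simp add: e(1) expo_degree_add expo_degree_eq_0)
    with m(2) e b show ?thesis by auto
  qed
  with v that show thesis by blast
qed

text \<open>
  Multiplying a nonzero cycle by a generator of \<open>I\<close> keeps it nonzero, and by degree reasons there are no
  nonzero boundaries.
\<close>

lemma tor_nonzero_Suc:
  assumes "k \<ge> 1" "tor_nonzero i (ideal_power I k) a" "g \<in> G"
  shows "tor_nonzero i (ideal_power I (Suc k)) (g + a)"
proof -
  let ?K = "koszul :: ('x, 'k) free_complex"
  obtain v where v: "v \<in> tor_cycles ?K i (ideal_power I k) a" "v \<noteq> 0"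
    using tor_cycle[OF assms(1,2)] by blast
  define w where "w = scal (monomial g) v"
  have "monomial g * f \<in> ideal_power I (Suc k)" if "f \<in> ideal_power I k" for f
    using that assms(3) by (auto simp: I_eq intro: ideal_times_mono ideal_gen_base)
  then have "w \<in> tensor ?K i (ideal_power I (Suc k))"
    using v(1) keys_scal[of "monomial g" v]
    by (auto simp: tor_cycles_def tensor_comp_def tensor_def w_def lookup_scal)
  moreover have "m + mdeg ?K i b = g + a" if b: "b \<in> basis ?K i" and m: "m \<in> keys (lookup w b)" for b m
  proof -
    obtain q where "m = g + q" "q \<in> keys (lookup v b)"
      using m keys_mult[of "monomial g" "lookup v b"] by (auto simp: w_def lookup_scal keys_monomial)
    then show ?thesis using v(1) b by (auto simp: tor_cycles_def tensor_comp_def add.assoc)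
  qed
  moreover have "koszul_bd w = 0" if "1 \<le> i"
    using v(1) that
    by (simp add: w_def tor_cycles_def koszul_simps module_hom.scale[OF module_hom_koszul_bd]
        module.scale_zero_right[OF module_scal])
  ultimately have w: "w \<in> tor_cycles ?K i (ideal_power I (Suc k)) (g + a)"
    by (simp add: tor_cycles_def tensor_comp_def koszul_simps(3))
  have "w \<noteq> 0"
  proof
    assume "w = 0"
    have "lookup (lookup v b) m = 0" for b m
    proof -
      have "lookup (lookup w b) (g + m) = lookup (lookup v b) m"
        by (simp add: w_def lookup_scal monomial_def lookup_single_times)
      with \<open>w = 0\<close> show ?thesis by simp
    qed
    then have "v = 0" by (intro poly_mapping_eqI) simp
    with v(2) show False by simp
  qed
  \<comment> \<open>A nonzero \<open>u\<close> would have degree at least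
    \<open>i + 1 + (k + 1) * d\<close>, exceeding the degree \<open>i + (k + 1) * d\<close> of
    \<open>g + a\<close> by one.\<close>
  have "u = 0" if u: "u \<in> tensor_comp ?K (i + 1) (ideal_power I (Suc k)) (g + a)" for u
  proof (rule ccontr)
    assume "u \<noteq> 0"
    then obtain b where b: "b \<in> keys u" by (metis keys_eq_empty all_not_in_conv)
    note key = tensor_comp_key[OF u[unfolded power_eq] b]
    obtain m where m: "m \<in> upset (nsums G (Suc k))" "m + mdeg ?K (i + 1) b = g + a" using key(2) by blast
    have "expo_degree m + (i + 1) = d + (i + k * d)"
      using arg_cong[OF m(2), of expo_degree] expo_degree_mdeg_koszul[OF key(1)] tor_degree[OF assms(1,2)]
        degree_G[OF assms(3)] by (simp add: expo_degree_add)
    with degree_upset[OF m(1)] show False by simp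
  qed
  then have "tor_boundaries ?K i (ideal_power I (Suc k)) (g + a) \<subseteq> {koszul_bd 0}"
    unfolding tor_boundaries_def koszul_simps(3) by blast
  then have "tor_boundaries ?K i (ideal_power I (Suc k)) (g + a) \<subseteq> {0}" by (simp only: koszul_bd_0)
  with w \<open>w \<noteq> 0\<close> show ?thesis
    unfolding power_eq tor_nonzero_iff_koszul by blast
qed

lemma tor_nonzero_nsums:
  assumes "k \<ge> 1" "tor_nonzero i (ideal_power I k) a" "e \<in> nsums G l"
  shows "tor_nonzero i (ideal_power I (l + k)) (e + a)"
  using assms(3)
proof (induction l arbitrary: e)
  case 0
  with assms(2) show ?case by simp
next
  case (Suc l)
  then obtain g e' where e: "e = g + e'" "g \<in> G" "e' \<in> nsums G l" by auto
  from tor_nonzero_Suc[OF _ Suc.IH[OF e(3)] e(2)] assms(1) show ?case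
    by (simp add: e(1) add.assoc)
qed

lemma HS_eq: "HS i J = ideal_gen (monomial ` {a. tor_nonzero i J a})"
  unfolding HS_def by (rule arg_cong[of _ _ ideal_gen]) auto

lemma times_HS_subset:
  assumes "k \<ge> 1"
  shows "ideal_times I (HS i (ideal_power I k)) \<subseteq> HS i (ideal_power I (k + 1))"
proof -
  have "ideal_times I (HS i (ideal_power I k)) =
      ideal_gen (monomial ` {g + a |g a. g \<in> G \<and> a \<in> {a. tor_nonzero i (ideal_power I k) a}})"
    unfolding HS_eq by (subst (1) I_eq) (rule ideal_times_monomials)
  also have "\<dots> \<subseteq> HS i (ideal_power I (k + 1))"
    unfolding HS_eq
    by (rule ideal_gen_least_gen) (use tor_nonzero_Suc[OF assms] in \<open>auto intro!: ideal_gen_base imageI\<close>)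
  finally show ?thesis .
qed

definition tor_support :: "nat \<Rightarrow> ('x expo \<times> nat) set" where
  "tor_support i = {(a, k). k \<ge> 1 \<and> tor_nonzero i (ideal_power I k) a}"

text \<open>
  A cycle in multidegree \<open>a\<close> supported on \<open>T\<close> writes \<open>a\<close>, for every \<open>b \<in> T\<close>, as the degree of \<open>b\<close>
  plus a sum of \<open>k\<close> elements of \<open>G\<close>. Decreasing the multiplicities \<open>l\<close> of the summands simultaneously
  for all \<open>b\<close> changes \<open>(a, k)\<close> by an element of the monoid generated by \<open>G \<times> {1}\<close>.
\<close>

lemma tor_support_finitely_generated:
  obtains B where "finite B" "B \<subseteq> tor_support i"
    "\<And>a k. (a, k) \<in> tor_support i \<Longrightarrow> \<exists>(a', k')\<in>B. \<exists>e\<in>nsums G (k - k'). k' \<le> k \<and> a = e + a'"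
proof -
  let ?K = "koszul :: ('x, 'k) free_complex"
  define rep where "rep T l a k \<longleftrightarrow> (\<forall>b\<in>T. k = (\<Sum>g\<in>G. l (b, g)) \<and>
      a = (\<Sum>g\<in>G. nat_mult (l (b, g)) g) + mdeg ?K i b)" for T :: "nat set" and l a k
  define L where "L T = {l. \<exists>a k. (a, k) \<in> tor_support i \<and> rep T l a k}" for T
  have fin: "finite (basis ?K i \<times> G)" by (simp add: finite_basis_koszul finite_G)
  have "\<forall>T. \<exists>M. finite M \<and> M \<subseteq> L T \<and> (\<forall>l\<in>L T. \<exists>b\<in>M. \<forall>x\<in>basis ?K i \<times> G. b x \<le> l x)"
    using dickson[OF fin] by blast
  then obtain M where M: "\<And>T. finite (M T)" "\<And>T. M T \<subseteq> L T"
    "\<And>T l. l \<in> L T \<Longrightarrow> \<exists>b\<in>M T. \<forall>x\<in>basis ?K i \<times> G. b x \<le> l x"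
    by metis
  have "\<forall>T. \<forall>l\<in>L T. \<exists>p. p \<in> tor_support i \<and> rep T l (fst p) (snd p)" by (auto simp: L_def)
  \<comment> \<open>\<open>P\<close> picks a pair of the support represented by the family
    \<open>l\<close>; for nonempty \<open>T\<close> this pair is determined by
    \<open>rep\<close>.\<close>
  then obtain P where P: "\<And>T l. l \<in> L T \<Longrightarrow> P T l \<in> tor_support i \<and> rep T l (fst (P T l)) (snd (P T l))"
    by metis
  \<comment> \<open>Finite because the Koszul basis in degree \<open>i\<close> has only finitely
    many subsets \<open>T\<close>, each contributing the finite Dickson set
    \<open>M T\<close>.\<close>
  define B where "B = (\<Union>T\<in>Pow (basis ?K i). P T ` M T)"
  show thesis
  proof
    show "finite B" unfolding B_def using M(1) by (simp add: finite_basis_koszul)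
    show "B \<subseteq> tor_support i" unfolding B_def using P M(2) by blast
    fix a k assume ak: "(a, k) \<in> tor_support i"
    then obtain v where v: "v \<in> tor_cycles ?K i (ideal_power I k) a" "v \<noteq> 0"
      "\<And>b. b \<in> keys v \<Longrightarrow> b \<in> basis ?K i \<and> (\<exists>e\<in>nsums G k. a = e + mdeg ?K i b)"
      using tor_cycle[of k i a] unfolding tor_support_def by blast
    have "\<exists>l. k = (\<Sum>g\<in>G. l g) \<and> a = (\<Sum>g\<in>G. nat_mult (l g) g) + mdeg ?K i b" if b: "b \<in> keys v" for b
    proof -
      obtain e where "e \<in> nsums G k" "a = e + mdeg ?K i b" using v(3)[OF b] by blast
      with nsums_imp_nat_mult[OF finite_G this(1)] show ?thesis by auto
    qed
    then obtain l where l: "\<And>b. b \<in> keys v \<Longrightarrow> k = (\<Sum>g\<in>G. l b g) \<and> a = (\<Sum>g\<in>G. nat_mult (l b g) g) + mdeg ?K i b"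
      by metis
    define T where "T = keys v"
    have rep: "rep T (\<lambda>(b, g). l b g) a k" using l by (simp add: rep_def T_def)
    with ak have "(\<lambda>(b, g). l b g) \<in> L T" by (auto simp: L_def)
    from M(3)[OF this] obtain l' where l': "l' \<in> M T" "\<And>b g. b \<in> basis ?K i \<Longrightarrow> g \<in> G \<Longrightarrow> l' (b, g) \<le> l b g"
      by fastforce
    obtain a' k' where ak': "P T l' = (a', k')" by (cases "P T l'")
    have rep': "rep T l' a' k'" using P[of l' T] M(2)[of T] l'(1) ak' by auto
    have T: "T \<subseteq> basis ?K i" using v(3) by (auto simp: T_def)
    \<comment> \<open>A nonzero cycle has nonempty support. At one \<open>b\<close> in it both pairs
      contain the same shift by the degree of \<open>b\<close>, so their difference is the sum of
      generators with multiplicities \<open>l - l'\<close>.\<close>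
    obtain b where b: "b \<in> T" using v(2) unfolding T_def by (metis keys_eq_empty all_not_in_conv)
    with T have b': "b \<in> basis ?K i" by blast
    have k: "k = k' + (\<Sum>g\<in>G. l b g - l' (b, g))"
    proof -
      have "(\<Sum>g\<in>G. l b g) = (\<Sum>g\<in>G. l' (b, g) + (l b g - l' (b, g)))"
        by (rule sum.cong) (use l'(2)[OF b'] in auto)
      then show ?thesis using rep rep' b by (simp add: rep_def sum.distrib)
    qed
    have a: "a = (\<Sum>g\<in>G. nat_mult (l b g - l' (b, g)) g) + a'"
    proof -
      have "(\<Sum>g\<in>G. nat_mult (l b g) g) = (\<Sum>g\<in>G. nat_mult (l' (b, g)) g + nat_mult (l b g - l' (b, g)) g)"
        by (rule sum.cong) (use l'(2)[OF b'] in \<open>auto simp: nat_mult_add[symmetric]\<close>)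
      then have "(\<Sum>g\<in>G. nat_mult (l b g) g) + mdeg ?K i b = (\<Sum>g\<in>G. nat_mult (l b g - l' (b, g)) g) + a'"
        using rep' b by (simp add: rep_def sum.distrib ac_simps)
      with rep b show ?thesis by (simp add: rep_def)
    qed
    have "(\<Sum>g\<in>G. nat_mult (l b g - l' (b, g)) g) \<in> nsums G (k - k')"
      using nat_mult_in_nsums[OF finite_G, of "\<lambda>g. l b g - l' (b, g)"] k by simp
    moreover have "(a', k') \<in> B" unfolding B_def ak'[symmetric] using l'(1) T by blast
    moreover have "k' \<le> k" using k by simp
    ultimately show "\<exists>(a', k')\<in>B. \<exists>e\<in>nsums G (k - k'). k' \<le> k \<and> a = e + a'" using a by blast
  qed
qed

section \<open>The homological shift algebra as a module over the Rees algebra\<close>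

definition HS_expos :: "nat \<Rightarrow> nat \<Rightarrow> 'x expo set" where
  "HS_expos i k = {a. (a, k) \<in> tor_support i}"

text \<open>In t-degree 0 the exponent set is empty, because \<open>tor_support\<close> requires
  \<open>k \<ge> 1\<close>, and the empty set generates the zero ideal. Thus all summands have the
  same monomial form.\<close>

lemma HS_summand_eq: "HS_summand i I k = ideal_gen (monomial ` HS_expos i k)"
proof (cases "k = 0")
  case True
  have "ideal_gen (monomial ` {}) = {0 :: ('x, 'k) poly_ring}"
    unfolding ideal_gen_monomials by (auto simp: upset_def)
  with True show ?thesis by (simp add: HS_summand_def HS_expos_def tor_support_def)
next
  case False
  then show ?thesis by (simp add: HS_summand_def HS_eq HS_expos_def tor_support_def)
qed

lemma times_HS_summand:
  assumes "s \<in> ideal_power I k" "t \<in> HS_summand i I l"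
  shows "s * t \<in> HS_summand i I (k + l)"
proof -
  have "e + a \<in> HS_expos i (k + l)" if "e \<in> nsums G k" "a \<in> HS_expos i l" for e a
    using that tor_nonzero_nsums[of l i a e k] by (simp add: HS_expos_def tor_support_def)
  from this assms show ?thesis
    unfolding HS_summand_eq power_eq by (rule times_mem_monomials)
qed

lemma bigraded_module_HS_algebra:
  "bigraded_module (rees_algebra I) (rees_comp I) (HS_algebra i I) (HS_comp i I)"
proof -
  have ring: "bigraded_ring (rees_algebra I) (rees_comp I)"
    unfolding I_eq by (rule bigraded_ring_rees_algebra)
  have group: "bigraded_group (HS_algebra i I) (HS_comp i I)"
    unfolding HS_comp_def by (rule bigraded_group_direct_sum[OF HS_summand_eq]) (simp_all add: HS_algebra_def)
  have "Module.module (rees_algebra I) (HS_algebra i I)"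
  proof (rule Module.moduleI)
    show "cring (rees_algebra I)" using ring by (simp add: bigraded_ring_def)
    show "abelian_group (HS_algebra i I)" using group by (simp add: bigraded_group_def)
  qed (auto simp: rees_algebra_def HS_algebra_def algebra_simps
      intro: times_mem_direct_sum[where N = "ideal_power I" and N' = "HS_summand i I"
      and N'' = "HS_summand i I", OF _ _ times_HS_summand HS_summand_eq])
  then show ?thesis
    unfolding bigraded_module_def using ring group
    by (auto simp: HS_algebra_def HS_comp_def rees_comp_def intro: times_mem_direct_sum_comp[where N = "ideal_power I" and N' = "HS_summand i I"
      and N'' = "HS_summand i I", OF _ _ times_HS_summand])
qed

text \<open>The monomials with exponent \<open>a\<close> in t-degree \<open>k\<close>, for
  \<open>(a, k) \<in> B\<close>, generate: every term of a member splits into such a generator and a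
  term of the Rees algebra in t-degree \<open>k - k'\<close>.\<close>

lemma finitely_generated_HS_algebra: "finitely_generated_module (rees_algebra I) (HS_algebra i I)"
proof -
  let ?R = "direct_sum (ideal_power I)" and ?M = "direct_sum (HS_summand i I)"
  obtain B where B: "finite B" "B \<subseteq> tor_support i"
    "\<And>a k. (a, k) \<in> tor_support i \<Longrightarrow> \<exists>(a', k')\<in>B. \<exists>e\<in>nsums G (k - k'). k' \<le> k \<and> a = e + a'"
    using tor_support_finitely_generated[of i] by blast
  define A where "A = (\<lambda>(a, k). single k (monomial a) :: ('x, 'k) poly_ring_t) ` B"
  have finA: "finite A" using B(1) by (simp add: A_def)
  have AM: "A \<subseteq> ?M"
  proof
    fix f assume "f \<in> A"
    then obtain a k where f: "f = single k (monomial a)" "(a, k) \<in> tor_support i" using B(2) by (auto simp: A_def)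
    then have "monomial a \<in> HS_summand i I k"
      unfolding HS_summand_eq by (intro ideal_gen_base) (simp add: HS_expos_def)
    then show "f \<in> ?M" by (auto simp: f direct_sum_def lookup_single when_def HS_summand_eq ideal_gen_0)
  qed
  define span where "span = {m. \<exists>r\<in>A \<rightarrow> ?R. m = (\<Sum>g\<in>A. r g * g)}"
  have R0: "0 \<in> ?R" by (simp add: direct_sum_def power_eq ideal_gen_0)
  have span_add: "m + m' \<in> span" if "m \<in> span" "m' \<in> span" for m m'
  proof -
    obtain r r' where r: "r \<in> A \<rightarrow> ?R" "m = (\<Sum>g\<in>A. r g * g)" "r' \<in> A \<rightarrow> ?R" "m' = (\<Sum>g\<in>A. r' g * g)"
      using \<open>m \<in> span\<close> \<open>m' \<in> span\<close> unfolding span_def by blast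
    have "(\<lambda>g. r g + r' g) \<in> A \<rightarrow> ?R"
      using r(1,3) by (auto simp: Pi_iff direct_sum_def lookup_add power_eq intro: ideal_gen_add)
    moreover have "m + m' = (\<Sum>g\<in>A. (r g + r' g) * g)" by (simp add: r distrib_right sum.distrib)
    ultimately show ?thesis unfolding span_def by (intro CollectI bexI)
  qed
  have span_0: "0 \<in> span" unfolding span_def using R0 by (auto intro!: bexI[of _ "\<lambda>_. 0"])
  have span_sum: "sum f X \<in> span" if "\<And>x. x \<in> X \<Longrightarrow> f x \<in> span" for f and X :: "'z set"
    using that by (induction X rule: infinite_finite_induct) (auto intro: span_0 span_add)
  have span_times: "s * g \<in> span" if "s \<in> ?R" "g \<in> A" for s g
  proof -
    let ?r = "\<lambda>h. if h = g then s else 0"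
    have "(\<Sum>h\<in>A. ?r h * h) = (\<Sum>h\<in>A. if h = g then s * g else 0)" by (rule sum.cong) auto
    then have "s * g = (\<Sum>h\<in>A. ?r h * h)" using that(2) finA by simp
    moreover have "?r \<in> A \<rightarrow> ?R" using that(1) R0 by auto
    ultimately show ?thesis unfolding span_def by (intro CollectI bexI)
  qed
  have span_term: "single k (single m c) \<in> span" if m: "m \<in> upset (HS_expos i k)" for k m and c :: 'k
  proof -
    obtain a t where a: "m = a + t" "(a, k) \<in> tor_support i" using m by (auto simp: upset_def HS_expos_def)
    from B(3)[OF a(2)] obtain a' k' e where e: "(a', k') \<in> B" "e \<in> nsums G (k - k')" "k' \<le> k" "a = e + a'"
      by blast
    \<comment> \<open>The cofactor \<open>t\<close> from S is absorbed into the Rees coefficient,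
      since \<open>ideal_power I (k - k')\<close> is an ideal.\<close>
    have "single (e + t) c \<in> ideal_power I (k - k')"
      using e(2) by (auto simp: power_eq ideal_gen_monomials upset_def)
    then have "single (k - k') (single (e + t) c) \<in> ?R"
      by (auto simp: direct_sum_def lookup_single when_def power_eq ideal_gen_0)
    moreover have "single k' (monomial a') \<in> A" using e(1) by (force simp: A_def)
    ultimately have "single (k - k') (single (e + t) c) * single k' (monomial a') \<in> span" by (rule span_times)
    moreover have "single (k - k') (single (e + t) c) * single k' (monomial a') = single k (single m c)"
      using e(3) by (simp add: mult_single monomial_def a(1) e(4) ac_simps)
    ultimately show ?thesis by simp
  qed
  have "m \<in> span" if m: "m \<in> ?M" for m
  proof -
    have "single k (lookup m k) \<in> span" for k
    proof -
      have "keys (lookup m k) \<subseteq> upset (HS_expos i k)"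
        using m by (simp add: direct_sum_def HS_summand_eq keys_subset_upset)
      then have "(\<Sum>q\<in>keys (lookup m k). single k (single q (lookup (lookup m k) q))) \<in> span"
        by (intro span_sum span_term) auto
      moreover have "(\<Sum>q\<in>keys f. single k (single q (lookup f q))) = single k f" for f :: "('x, 'k) poly_ring"
        by (subst (3) poly_mapping_sum_single[of f, symmetric])
          (rule poly_mapping_eqI, simp add: lookup_sum lookup_single when_def)
      ultimately show ?thesis by simp
    qed
    then have "(\<Sum>k\<in>keys m. single k (lookup m k)) \<in> span" by (intro span_sum)
    then show ?thesis by (simp add: poly_mapping_sum_single)
  qed
  moreover have "(\<Oplus>\<^bsub>HS_algebra i I\<^esub>g\<in>A. r g * g) = (\<Sum>g\<in>A. r g * g)" if "r \<in> A \<rightarrow> ?R" for r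
  proof (rule finsum_eq_sum)
    show "abelian_monoid (HS_algebra i I)"
      using bigraded_module_HS_algebra[of i]
      by (auto simp: bigraded_module_def bigraded_group_def intro: abelian_group.axioms)
    show "(\<lambda>g. r g * g) \<in> A \<rightarrow> carrier (HS_algebra i I)"
      using that AM by (auto simp: HS_algebra_def Pi_iff intro!: times_mem_direct_sum[where N = "ideal_power I" and N' = "HS_summand i I"
      and N'' = "HS_summand i I", OF _ _ times_HS_summand HS_summand_eq])
  qed (simp_all add: HS_algebra_def)
  ultimately have "\<forall>m\<in>?M. \<exists>r\<in>A \<rightarrow> ?R. m = (\<Oplus>\<^bsub>HS_algebra i I\<^esub>g\<in>A. r g * g)"
    unfolding span_def by fastforce
  with finA AM show ?thesis
    unfolding finitely_generated_module_def by (intro exI[of _ A]) (simp add: HS_algebra_def rees_algebra_def)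
qed

end

theorem theorem1p4:
  fixes I :: "('x::finite, 'k::field) poly_ring set" and i :: nat
  assumes "monomial_ideal I"
    and "linear_powers I"
  shows "(\<forall>k\<ge>1. ideal_times I (HS i (ideal_power I k)) \<subseteq> HS i (ideal_power I (k + 1))) \<and>
    bigraded_module (rees_algebra I) (rees_comp I) (HS_algebra i I) (HS_comp i I) \<and>
    finitely_generated_module (rees_algebra I) (HS_algebra i I)"
proof -
  obtain A where A: "I = ideal_gen (monomial ` A)" using assms(1) by (auto simp: monomial_ideal_def)
  \<comment> \<open>By definition the first power is \<open>I\<close> times the whole ring.
    Identifying it with \<open>I\<close> lets the case \<open>k = 1\<close> of linear powers supply
    the common degree of the generators.\<close>
  have "nsums A 1 = A" by auto
  then have "ideal_power I 1 = I" unfolding A ideal_power_monomials by simp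
  then obtain d where "generated_in_degree d I"
    using assms(2) unfolding linear_powers_def has_linear_resolution_def by (metis order_refl)
  with monomial_generators_in_degree[OF assms(1)] obtain G
    where "\<forall>g\<in>G. expo_degree g = d" "I = ideal_gen (monomial ` G)" by blast
  then interpret linear_powers_ideal G d I
    using assms(2) by unfold_locales auto
  show ?thesis
    using times_HS_subset bigraded_module_HS_algebra finitely_generated_HS_algebra by simp
qed

end
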